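(* Let $h,g\in\ell^2(\mathbb{Z})$ with $h$ a low-pass filter and $g$ a high-pass filter. Assume that $g$ is finitely supported and that $$\hat h(\xi)=\sqrt2\left[\frac{1+e^{2\pi i\xi}}{2}\right]^n p(\xi),$$ where $n\in\mathbb{N}$ and $p$ is a trigonometric polynomial satisfying $p(0)=1$. Suppose that there exists $s\in\mathbb{N}$ such that $$\sup_{\xi\in\mathbb{R}}\left|\prod_{k=0}^{s-1}p(2^k\xi)\right|<2^{(n-\frac12)s},$$ and that the matrix $$M(\xi):=\frac1{\sqrt2}\begin{bmatrix}\hat g(\xi)&\hat h(\xi)\\ \hat g(\xi+\frac12)&\hat h(\xi+\frac12)\end{bmatrix}$$ is expanding in the sense that $\|M(\xi)c\|\ge\|c\|$ for all $c\in\mathbb{C}^2$ and almost every $\xi\in\mathbb{T}$. Then the infinitely iterated dyadic filter bank generated by $h$ and $g$ is stable.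
   Context: $\mathbb{N}=\{1,2,\dots\}$; $\mathbb{T}$ is identified with $[-\frac12,\frac12)$. For $x,y\in\ell^2(\mathbb{Z})$: $\hat x(\xi)=\sum_n x(n)e^{-2\pi i n\xi}$ (a 1-periodic function on $\mathbb{R}$); $\langle x,y\rangle=\sum_m x(m)\overline{y(m)}$; convolution $(x*y)(k)=\sum_{n} y(n)x(k-n)$; involution $\overline{x}(k)=\overline{x(-k)}$; downsampling $Dx(n)=x(2n)$; upsampling $Ux(2m)=x(m)$, $Ux(n)=0$ for $n$ odd; translation $Tx(k)=x(k-1)$. A trigonometric polynomial is a finite sum $\sum_m p_me^{-2\pi i m\xi}$ with $p_m\in\mathbb{C}$, $m\in\mathbb{Z}$. A low-pass filter $h$ satisfies $\hat h(0)=\sqrt2$ and $\hat h(\frac12)=0$; a high-pass filter $g$ satisfies $\hat g(0)=0$. Given filters $h,g$, the iterated filters of order $j\in\mathbb{N}$ are $h_j=h*Uh*\cdots*U^{j-1}h$ and $g_j=h_{j-1}*U^{j-1}g$ (with $g_1=g$, i.e. $h_0=\delta_0$). Infinitely iterated dyadic filter bank: the components of the analysis operator are $(Fx)_j=D^j(x*\overline{g_j})$, i.e. $(Fx)_j(k)=\langle x,T^{2^jk}g_j\rangle$, $j\in\mathbb{N}$, $k\in\mathbb{Z}$. It is stable if there exist constants $0<A\le B<\infty$ such that $A\|x\|^2\le\sum_{j=1}^\infty\|(Fx)_j\|^2\le B\|x\|^2$ for all $x\in\ell^2(\mathbb{Z})$, equivalently if $\{T^{2^jk}g_j: j\in\mathbb{N},k\in\mathbb{Z}\}$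 is a frame for $\ell^2(\mathbb{Z})$. *)

theory Defs
  imports "HOL-Analysis.Analysis"
begin

section \<open>Sequences on the integers\<close>

definition ell2 :: "(int \<Rightarrow> complex) set" where
  "ell2 = {x. (\<lambda>n. (cmod (x n))\<^sup>2) summable_on UNIV}"

definition ell2_norm :: "(int \<Rightarrow> complex) \<Rightarrow> real" where
  "ell2_norm x = sqrt (\<Sum>\<^sub>\<infinity>n. (cmod (x n))\<^sup>2)"

text \<open>
  The series is summed unconditionally (equivalently, absolutely); for a sequence that is not
  absolutely summable the value is 0 at every point.
\<close>
definition dtft :: "(int \<Rightarrow> complex) \<Rightarrow> real \<Rightarrow> complex" where
  "dtft x \<xi> = (\<Sum>\<^sub>\<infinity>n. x n * exp (- 2 * of_real pi * \<i> * of_int n * of_real \<xi>))"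

definition conv :: "(int \<Rightarrow> complex) \<Rightarrow> (int \<Rightarrow> complex) \<Rightarrow> int \<Rightarrow> complex" where
  "conv x y k = (\<Sum>\<^sub>\<infinity>n. y n * x (k - n))"

definition invol :: "(int \<Rightarrow> complex) \<Rightarrow> int \<Rightarrow> complex" where
  "invol x k = cnj (x (- k))"

definition downsample :: "(int \<Rightarrow> complex) \<Rightarrow> int \<Rightarrow> complex" where
  "downsample x n = x (2 * n)"

definition upsample :: "(int \<Rightarrow> complex) \<Rightarrow> int \<Rightarrow> complex" where
  "upsample x n = (if even n then x (n div 2) else 0)"

definition unit_impulse :: "int \<Rightarrow> complex" where
  "unit_impulse k = (if k = 0 then 1 else 0)"

section \<open>Filters and trigonometric polynomials\<close>

definition trig_poly :: "(real \<Rightarrow> complex) \<Rightarrow> bool" where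
  "trig_poly p \<longleftrightarrow> (\<exists>S :: int set. \<exists>c :: int \<Rightarrow> complex. finite S \<and>
     (\<forall>\<xi>. p \<xi> = (\<Sum>m\<in>S. c m * exp (- 2 * of_real pi * \<i> * of_int m * of_real \<xi>))))"

definition low_pass :: "(int \<Rightarrow> complex) \<Rightarrow> bool" where
  "low_pass h \<longleftrightarrow> dtft h 0 = of_real (sqrt 2) \<and> dtft h (1/2) = 0"

definition high_pass :: "(int \<Rightarrow> complex) \<Rightarrow> bool" where
  "high_pass g \<longleftrightarrow> dtft g 0 = 0"

definition modulation_matrix ::
    "(int \<Rightarrow> complex) \<Rightarrow> (int \<Rightarrow> complex) \<Rightarrow> real \<Rightarrow> complex^2^2" where
  "modulation_matrix h g \<xi> = (1 / sqrt 2) *\<^sub>R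
     vector [vector [dtft g \<xi>, dtft h \<xi>],
             vector [dtft g (\<xi> + 1/2), dtft h (\<xi> + 1/2)]]"

text \<open>The torus is identified with the interval from -1/2 (included) to 1/2 (excluded).\<close>
definition expanding_ae :: "(real \<Rightarrow> complex^2^2) \<Rightarrow> bool" where
  "expanding_ae M \<longleftrightarrow>
     (AE \<xi> in lebesgue_on {-1/2..<1/2}. \<forall>c :: complex^2. norm (M \<xi> *v c) \<ge> norm c)"

section \<open>The infinitely iterated dyadic filter bank\<close>

fun iter_low :: "(int \<Rightarrow> complex) \<Rightarrow> nat \<Rightarrow> int \<Rightarrow> complex" where
  "iter_low h 0 = unit_impulse"
| "iter_low h (Suc j) = conv (iter_low h j) ((upsample ^^ j) h)"

text \<open>Only orders \<open>j \<ge> 1\<close> are meaningful here and in \<open>analysis\<close>.\<close>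
definition iter_high :: "(int \<Rightarrow> complex) \<Rightarrow> (int \<Rightarrow> complex) \<Rightarrow> nat \<Rightarrow> int \<Rightarrow> complex" where
  "iter_high h g j = conv (iter_low h (j - 1)) ((upsample ^^ (j - 1)) g)"

definition analysis ::
    "(int \<Rightarrow> complex) \<Rightarrow> (int \<Rightarrow> complex) \<Rightarrow> nat \<Rightarrow> (int \<Rightarrow> complex) \<Rightarrow> int \<Rightarrow> complex" where
  "analysis h g j x = (downsample ^^ j) (conv x (invol (iter_high h g j)))"

text \<open>
  Finiteness of the norms and of their square sum is demanded explicitly, since the real-valued
  infinite sums are 0 when they diverge.
\<close>
definition stable_filter_bank :: "(int \<Rightarrow> complex) \<Rightarrow> (int \<Rightarrow> complex) \<Rightarrow> bool" where
  "stable_filter_bank h g \<longleftrightarrow> (\<exists>A B :: real. 0 < A \<and> A \<le> B \<and>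
     (\<forall>x\<in>ell2.
        (\<forall>j\<ge>1. analysis h g j x \<in> ell2) \<and>
        (\<lambda>j. (ell2_norm (analysis h g j x))\<^sup>2) summable_on {1..} \<and>
        A * (ell2_norm x)\<^sup>2 \<le> (\<Sum>\<^sub>\<infinity>j\<in>{1..}. (ell2_norm (analysis h g j x))\<^sup>2) \<and>
        (\<Sum>\<^sub>\<infinity>j\<in>{1..}. (ell2_norm (analysis h g j x))\<^sup>2) \<le> B * (ell2_norm x)\<^sup>2))"

lemma downsample_funpow: "(downsample ^^ j) x k = x (2 ^ j * k)"
  by (induction j arbitrary: k) (simp_all add: downsample_def ac_simps)

text \<open>The analysis coefficients are the inner products of \<open>x\<close> with the translates of the
  iterated filter by multiples of \<open>2 ^ j\<close>.\<close>
lemma analysis_eq_inner: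
  "analysis h g j x k = (\<Sum>\<^sub>\<infinity>m. x m * cnj (iter_high h g j (m - 2 ^ j * k)))"
proof -
  have bij: "bij_betw (\<lambda>m. 2 ^ j * k - m) UNIV (UNIV :: int set)"
    by (rule bij_betwI[where g = "\<lambda>m. 2 ^ j * k - m"]) auto
  have "analysis h g j x k
      = (\<Sum>\<^sub>\<infinity>n. cnj (iter_high h g j (- n)) * x (2 ^ j * k - n))"
    by (simp add: analysis_def downsample_funpow conv_def invol_def)
  also have "\<dots> = (\<Sum>\<^sub>\<infinity>m. x m * cnj (iter_high h g j (m - 2 ^ j * k)))"
    by (subst infsum_reindex_bij_betw[OF bij, symmetric]) (simp add: mult.commute)
  finally show ?thesis .
qed

end

theory Submission imports Defs begin

text \<open>One level of the bank sends \<open>x\<close> to its detail coefficients and its approximation coefficients,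
  both computed in frequency by the adjoint of the modulation matrix. That adjoint is expanding
  together with the matrix (\<open>adjoint_expanding\<close>), so one level loses no energy
  (\<open>energy_one_level\<close>). Iterating \<open>J\<close> times, the energy of \<open>x\<close> is at most the energy of the
  details of levels \<open>1\<close> to \<open>J\<close> plus that of the approximation of level \<open>J\<close>. The lower frame bound
  therefore follows once the approximation energy tends to zero, and the upper one is a Bessel
  estimate for the details. Both rest on one pointwise bound for the iterated low-pass filter.

  Writing \<open>\<sigma> = \<bar>sin (pi \<xi>)\<bar>\<close>, the cosine factors of the product of the \<open>J\<close> dilates of the low-pass
  symbol telescope to \<open>sin (2^J pi \<xi>) / (2^J sin (pi \<xi>))\<close>, which gives decay of order \<open>n\<close> in
  \<open>2^J \<sigma>\<close>. The product of the dilates of \<open>p\<close> is bounded while \<open>2^k \<sigma> \<le> 1\<close>, because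
  \<open>p\<close> is Lipschitz at \<open>0\<close> with value \<open>1\<close>; beyond that frequency the hypothesis on blocks of \<open>s\<close>
  factors limits its growth to an exponent strictly below \<open>n - 1/2\<close> (\<open>prod_dilates_le\<close>). Hence,
  for a small \<open>\<delta> > 0\<close>, the squared symbol of level \<open>J\<close> is at most a constant times
  \<open>2^J max(1, 2^J \<sigma>)^(-1 - 3 \<delta>)\<close>
  (\<open>low_pass_product_bound\<close>). It is the strict inequality in the hypothesis that pays for \<open>\<delta>\<close>.

  The power is split as \<open>-(1 + \<delta>)\<close> and \<open>-2 \<delta>\<close>. In the Cauchy-Schwarz inequality over the \<open>2^J\<close>
  frequencies that are folded together by downsampling, the first part is summable over the coset
  uniformly (\<open>coset_sum_bounded\<close>), and the second remains as a weight on the spectrum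
  of \<open>x\<close> (\<open>energy_translates_le\<close>). For the approximations this weight tends to zero away from the
  integers, so their energy decays geometrically (\<open>approx_energy_decay\<close>). For the
  details the high-pass factor vanishes at the integers and adds \<open>min(1, 2^j \<sigma>)^2\<close>, after which the
  weights of all levels have a bounded sum (\<open>dyadic_sum_bounded\<close>), and the Bessel bound follows
  (\<open>detail_energy_sum_le\<close>).

  All of this is carried out for finitely supported sequences, where integrals over the torus can be
  replaced by averages over sufficiently fine grids of roots of unity (\<open>parseval\<close>), and every
  identity is one between finite sums. The filters have finite support: a summable
  sequence whose transform is a trigonometric polynomial is finitely supported
  (\<open>fin_supp_of_dtft_trig_poly\<close>). Each single analysis coefficient then sees
  only a finite window of the input, so the frame bounds pass to all of \<open>ell2\<close> by truncation
  (\<open>stable_from_finite_support\<close>).\<close>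

section \<open>Finitely supported sequences and their transforms\<close>

definition character :: "int \<Rightarrow> real \<Rightarrow> complex" where
  "character m \<xi> = cis (- (2 * pi * of_int m * \<xi>))"

lemma exp_eq_character: "exp (- 2 * of_real pi * \<i> * of_int m * of_real \<xi>) = character m \<xi>"
  by (simp add: character_def cis_conv_exp algebra_simps)

lemma norm_character [simp]: "cmod (character m \<xi>) = 1"
  by (simp add: character_def)

lemma character_0 [simp]: "character 0 \<xi> = 1" "character m 0 = 1"
  by (simp_all add: character_def)

lemma character_add: "character (m + n) \<xi> = character m \<xi> * character n \<xi>"
  by (simp add: character_def cis_mult algebra_simps)

lemma character_arg_add: "character m (\<xi> + \<eta>) = character m \<xi> * character m \<eta>"
  by (simp add: character_def cis_mult algebra_simps)

lemma character_diff: "character (m - n) \<xi> = character m \<xi> * character (- n) \<xi>"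
  using character_add[of m "- n" \<xi>] by simp

lemma cnj_character: "cnj (character m \<xi>) = character (- m) \<xi>"
  by (simp add: character_def cis_cnj)

lemma character_scale: "character (a * m) \<xi> = character m (of_int a * \<xi>)"
  by (simp add: character_def algebra_simps)

lemma character_power: "character m \<xi> ^ r = character m (real r * \<xi>)"
  unfolding character_def Complex.DeMoivre by (rule arg_cong[where f = cis]) simp

lemma character_int [simp]: "character m (of_int k) = 1"
proof -
  have "character m (of_int k) = cis (2 * pi * of_int (- m * k))"
    by (simp add: character_def algebra_simps)
  then show ?thesis by (simp only: cis_multiple_2pi Ints_of_int)
qed

lemma character_eq_1_iff: "character m \<xi> = 1 \<longleftrightarrow> real_of_int m * \<xi> \<in> \<int>"
proof
  assume "character m \<xi> = 1"
  then have "cos (2 * pi * of_int m * \<xi>) = 1" by (simp add: character_def complex_eq_iff)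
  then obtain k :: int where "2 * pi * of_int m * \<xi> = of_int k * 2 * pi"
    by (auto simp: cos_one_2pi_int)
  then have "real_of_int m * \<xi> = of_int k" by simp
  then show "real_of_int m * \<xi> \<in> \<int>" by simp
next
  assume "real_of_int m * \<xi> \<in> \<int>"
  then obtain k where "real_of_int m * \<xi> = of_int k" by (auto elim: Ints_cases)
  then have "character m \<xi> = character 1 (of_int k)" using character_scale[of m 1 \<xi>] by simp
  then show "character m \<xi> = 1" by simp
qed

text \<open>The geometric sum of the \<open>m\<close>-th powers of the \<open>N\<close>-th roots of unity: the orthogonality relation
  behind both Parseval's identity and the aliasing formula below.\<close>

lemma sum_character:
  assumes "N > 0"
  shows "(\<Sum>r<N. character m (real r / real N)) = (if int N dvd m then of_nat N else 0)"
proof -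
  define w where "w = character m (1 / real N)"
  have pw: "character m (real r / real N) = w ^ r" for r
    by (simp add: w_def character_power)
  have w1: "w = 1 \<longleftrightarrow> int N dvd m"
  proof -
    have "w = 1 \<longleftrightarrow> real_of_int m / real_of_int (int N) \<in> \<int>"
      by (simp add: w_def character_eq_1_iff)
    also have "\<dots> \<longleftrightarrow> int N dvd m"
      using assms
      by (metis of_int_div_of_int_in_Ints_iff of_nat_eq_0_iff not_gr_zero)
    finally show ?thesis .
  qed
  show ?thesis
  proof (cases "w = 1")
    case True then show ?thesis using w1 by (simp add: pw)
  next
    case False
    have "w ^ N = character m (of_int 1)" using assms by (simp add: w_def character_power)
    then have "w ^ N = 1" by (simp only: character_int)
    then have "(\<Sum>r<N. w ^ r) = 0" using False by (simp add: sum_gp_strict)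
    then show ?thesis using False w1 by (simp add: pw)
  qed
qed

abbreviation fin_supp :: "(int \<Rightarrow> complex) \<Rightarrow> bool" where
  "fin_supp x \<equiv> finite {k. x k \<noteq> 0}"

lemma dtft_character: "dtft x \<xi> = (\<Sum>\<^sub>\<infinity>n. x n * character n \<xi>)"
  by (simp only: dtft_def exp_eq_character)

lemma infsum_eq_sum:
  fixes f :: "'a \<Rightarrow> 'b::{comm_monoid_add, t2_space}"
  assumes "finite S" "\<And>k. k \<notin> S \<Longrightarrow> f k = 0"
  shows "(\<Sum>\<^sub>\<infinity>k. f k) = (\<Sum>k\<in>S. f k)"
proof -
  have "(\<Sum>\<^sub>\<infinity>k. f k) = (\<Sum>\<^sub>\<infinity>k\<in>S. f k)"
    by (rule infsum_cong_neutral) (use assms in auto)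
  then show ?thesis using assms by simp
qed

lemma dtft_finite:
  assumes "finite S" "\<And>k. k \<notin> S \<Longrightarrow> x k = 0"
  shows "dtft x \<xi> = (\<Sum>n\<in>S. x n * character n \<xi>)"
  unfolding dtft_character by (rule infsum_eq_sum) (use assms in auto)

lemma dtft_fin_supp:
  assumes "fin_supp x"
  shows "dtft x \<xi> = (\<Sum>n | x n \<noteq> 0. x n * character n \<xi>)"
  by (rule dtft_finite) (use assms in auto)

lemma dtft_add_int:
  shows "dtft x (\<xi> + of_int k) = dtft x \<xi>"
  by (simp add: dtft_character character_arg_add)

lemma dtft_bounded:
  assumes "fin_supp x"
  obtains X where "\<And>\<xi>. cmod (dtft x \<xi>) \<le> X"
proof
  fix \<xi>
  show "cmod (dtft x \<xi>) \<le> (\<Sum>n | x n \<noteq> 0. cmod (x n))"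
    unfolding dtft_fin_supp[OF assms]
    by (rule sum_norm_le) (simp add: norm_mult)
qed

lemma dtft_continuous:
  assumes "fin_supp x"
  shows "continuous_on UNIV (dtft x)"
proof -
  have *: "dtft x = (\<lambda>\<xi>. \<Sum>n | x n \<noteq> 0. x n * cis (- (2 * pi * of_int n * \<xi>)))"
    using dtft_fin_supp[OF assms] by (auto simp: character_def)
  show ?thesis unfolding * by (intro continuous_intros)
qed

section \<open>Energy on grids of roots of unity\<close>

definition energy :: "(int \<Rightarrow> complex) \<Rightarrow> real" where
  "energy x = (\<Sum>\<^sub>\<infinity>n. (cmod (x n))\<^sup>2)"

lemma energy_nonneg: "energy x \<ge> 0"
  unfolding energy_def by (rule infsum_nonneg) simp

lemma ell2_norm_sq: "(ell2_norm x)\<^sup>2 = energy x"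
  using energy_nonneg[of x] by (simp add: ell2_norm_def energy_def)

lemma energy_fin_supp:
  assumes "fin_supp x"
  shows "energy x = (\<Sum>n | x n \<noteq> 0. (cmod (x n))\<^sup>2)"
  unfolding energy_def by (rule infsum_eq_sum) (use assms in auto)

text \<open>On the grid of \<open>N\<close>-th roots of unity the characters of two integers are orthogonal unless the
  integers agree modulo \<open>N\<close>. As soon as \<open>N\<close> exceeds the diameter of the support, congruent indices
  of the support coincide.\<close>

lemma parseval:
  assumes x: "fin_supp x"
  shows "eventually (\<lambda>N. energy x = (\<Sum>r<N. (cmod (dtft x (real r / real N)))\<^sup>2) / real N) sequentially"
proof -
  define S where "S = {k. x k \<noteq> 0}"
  have fS: "finite S" using x by (simp add: S_def)
  define D where "D = Max (insert 0 ((\<lambda>(k, l). \<bar>k - l\<bar>) ` (S \<times> S)))"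
  have D: "\<bar>k - l\<bar> \<le> D" if "k \<in> S" "l \<in> S" for k l
    unfolding D_def by (rule Max_ge) (use fS that in force)+
  have D0: "D \<ge> 0" unfolding D_def by (rule Max_ge) (use fS in force)+
  have main: "energy x = (\<Sum>r<N. (cmod (dtft x (real r / real N)))\<^sup>2) / real N"
    if N: "N \<ge> nat D + 1" for N
  proof -
    have N0: "N > 0" using N by simp
    have cong: "int N dvd l - k \<longleftrightarrow> l = k" if "k \<in> S" "l \<in> S" for k l
    proof
      assume "int N dvd l - k"
      moreover have "\<bar>l - k\<bar> < int N" using D[OF that(2,1)] N by linarith
      ultimately show "l = k" using zdvd_imp_le[of "int N" "\<bar>l - k\<bar>"] by fastforce
    qed simp
    have "of_real (\<Sum>r<N. (cmod (dtft x (real r / real N)))\<^sup>2)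
        = (\<Sum>r<N. dtft x (real r / real N) * cnj (dtft x (real r / real N)))"
      by (simp only: of_real_sum complex_norm_square)
    also have "\<dots> = (\<Sum>r<N. \<Sum>l\<in>S. \<Sum>k\<in>S. (x l * cnj (x k)) * character (l - k) (real r / real N))"
      by (simp add: dtft_fin_supp[OF x] S_def[symmetric] sum_product cnj_character
          character_diff mult_ac)
    also have "\<dots> = (\<Sum>l\<in>S. \<Sum>k\<in>S. (x l * cnj (x k)) * (\<Sum>r<N. character (l - k) (real r / real N)))"
      by (subst sum.swap, rule sum.cong[OF refl], subst sum.swap) (simp add: sum_distrib_left)
    also have "\<dots> = (\<Sum>l\<in>S. \<Sum>k\<in>S. if k = l then (x l * cnj (x l)) * of_nat N else 0)"
      by (intro sum.cong refl) (auto simp: sum_character[OF N0] cong)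
    also have "\<dots> = (\<Sum>k\<in>S. x k * cnj (x k) * of_nat N)"
      using fS by simp
    also have "\<dots> = of_real (real N * energy x)"
      unfolding energy_fin_supp[OF x] S_def[symmetric] sum_distrib_left of_real_sum of_real_mult
        complex_norm_square by (simp add: mult.commute)
    finally show ?thesis using N0 by (simp only: of_real_eq_iff) simp
  qed
  then show ?thesis unfolding eventually_sequentially by blast
qed

text \<open>Averaging over the \<open>M\<close> frequencies that differ by multiples of \<open>1/M\<close> annihilates exactly the
  characters whose index is not a multiple of \<open>M\<close>; this is the aliasing formula for downsampling.\<close>

lemma dtft_decimate:
  assumes z: "fin_supp z" and M: "M > 0"
  shows "fin_supp (\<lambda>k. z (int M * k))"
    and "dtft (\<lambda>k. z (int M * k)) \<zeta> = (\<Sum>k<M. dtft z ((\<zeta> + real k) / real M)) / of_nat M"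
proof -
  define S where "S = {k. z k \<noteq> 0}"
  have fS: "finite S" using z by (simp add: S_def)
  define T where "T = {k. z (int M * k) \<noteq> 0}"
  have inj: "inj_on ((*) (int M)) T" using M by (simp add: inj_on_def)
  have img: "(*) (int M) ` T = {m \<in> S. int M dvd m}"
    by (auto simp: T_def S_def dvd_def)
  show fT: "fin_supp (\<lambda>k. z (int M * k))"
  proof -
    have "finite ((*) (int M) ` T)" unfolding img using fS by simp
    then show ?thesis using inj unfolding T_def by (rule finite_imageD)
  qed
  have "(\<Sum>k<M. dtft z ((\<zeta> + real k) / real M))
      = (\<Sum>k<M. \<Sum>m\<in>S. z m * character m (\<zeta> / real M) * character m (real k / real M))"
    by (simp add: dtft_fin_supp[OF z] S_def add_divide_distrib character_arg_add mult.assoc)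
  also have "\<dots> = (\<Sum>m\<in>S. z m * character m (\<zeta> / real M) * (\<Sum>k<M. character m (real k / real M)))"
    by (subst sum.swap) (simp add: sum_distrib_left)
  also have "\<dots> = (\<Sum>m\<in>S. if int M dvd m then z m * character m (\<zeta> / real M) * of_nat M else 0)"
    by (simp add: sum_character[OF M] if_distrib cong: if_cong)
  also have "\<dots> = (\<Sum>m\<in>(*) (int M) ` T. z m * character m (\<zeta> / real M) * of_nat M)"
    unfolding img using fS by (simp add: sum.inter_filter)
  also have "\<dots> = (\<Sum>k\<in>T. z (int M * k) * character k \<zeta> * of_nat M)"
    using M by (simp add: sum.reindex[OF inj] character_scale)
  also have "\<dots> = dtft (\<lambda>k. z (int M * k)) \<zeta> * of_nat M"
    by (simp add: dtft_fin_supp[OF fT] T_def sum_distrib_right)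
  finally show "dtft (\<lambda>k. z (int M * k)) \<zeta> = (\<Sum>k<M. dtft z ((\<zeta> + real k) / real M)) / of_nat M"
    using M by simp
qed

section \<open>Transforms of the iterated filters\<close>

lemma dtft_conv:
  assumes x: "fin_supp x" and y: "fin_supp y"
  shows "fin_supp (conv x y)" and "dtft (conv x y) \<xi> = dtft x \<xi> * dtft y \<xi>"
proof -
  define S where "S = {k. x k \<noteq> 0}"
  define T where "T = {k. y k \<noteq> 0}"
  have fS: "finite S" and fT: "finite T" using x y by (simp_all add: S_def T_def)
  have cv: "conv x y k = (\<Sum>n\<in>T. y n * x (k - n))" for k
    unfolding conv_def by (rule infsum_eq_sum) (use fT in \<open>auto simp: T_def\<close>)
  define R where "R = (\<lambda>(k, n). k + n) ` (S \<times> T)"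
  have fR: "finite R" using fS fT by (simp add: R_def)
  have zero: "y n * x (k - n) = 0" if "k \<notin> R" for k n
  proof (rule ccontr)
    assume "y n * x (k - n) \<noteq> 0"
    then have "(k - n, n) \<in> S \<times> T" by (auto simp: S_def T_def)
    then have "k \<in> R" unfolding R_def by force
    with that show False by simp
  qed
  have sub: "conv x y k = 0" if "k \<notin> R" for k
    unfolding cv by (rule sum.neutral) (use zero[OF that] in blast)
  then show "fin_supp (conv x y)"
    by (rule_tac finite_subset[OF _ fR]) auto
  have "dtft (conv x y) \<xi> = (\<Sum>k\<in>R. \<Sum>n\<in>T. y n * x (k - n) * character k \<xi>)"
    by (simp add: dtft_finite[OF fR sub] cv sum_distrib_right)
  also have "\<dots> = (\<Sum>n\<in>T. \<Sum>k\<in>R. y n * x (k - n) * character k \<xi>)"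
    by (rule sum.swap)
  also have "\<dots> = (\<Sum>n\<in>T. \<Sum>l\<in>S. y n * x l * character (l + n) \<xi>)"
  proof (rule sum.cong[OF refl])
    fix n assume n: "n \<in> T"
    show "(\<Sum>k\<in>R. y n * x (k - n) * character k \<xi>) = (\<Sum>l\<in>S. y n * x l * character (l + n) \<xi>)"
    proof (rule sum.reindex_bij_witness_not_neutral[where S' = "{k\<in>R. k - n \<notin> S}" and T' = "{}"
          and i = "\<lambda>l. l + n" and j = "\<lambda>k. k - n"])
    qed (use n fR in \<open>auto simp: S_def R_def\<close>)
  qed
  also have "\<dots> = (\<Sum>n\<in>T. y n * character n \<xi>) * (\<Sum>l\<in>S. x l * character l \<xi>)"
    unfolding sum_product character_add by (simp only: mult_ac)
  also have "\<dots> = dtft x \<xi> * dtft y \<xi>"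
    by (simp add: dtft_fin_supp[OF x] dtft_fin_supp[OF y] S_def T_def)
  finally show "dtft (conv x y) \<xi> = dtft x \<xi> * dtft y \<xi>" .
qed

lemma dtft_invol:
  assumes x: "fin_supp x"
  shows "fin_supp (invol x)" and "dtft (invol x) \<xi> = cnj (dtft x \<xi>)"
proof -
  have eq: "{k. invol x k \<noteq> 0} = uminus ` {k. x k \<noteq> 0}"
    by (force simp: invol_def image_iff)
  show f: "fin_supp (invol x)" unfolding eq using x by simp
  show "dtft (invol x) \<xi> = cnj (dtft x \<xi>)"
    unfolding dtft_fin_supp[OF f] dtft_fin_supp[OF x] eq
    by (subst sum.reindex) (simp_all add: invol_def cnj_character)
qed

lemma dtft_upsample:
  assumes x: "fin_supp x"
  shows "fin_supp (upsample x)" and "dtft (upsample x) \<xi> = dtft x (2 * \<xi>)"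
proof -
  have eq: "{k. upsample x k \<noteq> 0} = (*) 2 ` {k. x k \<noteq> 0}"
    by (auto simp: upsample_def)
  show f: "fin_supp (upsample x)" unfolding eq using x by simp
  show "dtft (upsample x) \<xi> = dtft x (2 * \<xi>)"
    unfolding dtft_fin_supp[OF f] dtft_fin_supp[OF x] eq
    by (subst sum.reindex) (simp_all add: upsample_def character_scale inj_on_def)
qed

lemma dtft_upsample_funpow:
  assumes x: "fin_supp x"
  shows "fin_supp ((upsample ^^ j) x) \<and> dtft ((upsample ^^ j) x) \<xi> = dtft x (2 ^ j * \<xi>)"
  using assms
proof (induction j arbitrary: \<xi>)
  case (Suc j)
  then show ?case
    using dtft_upsample[of "(upsample ^^ j) x"] by (simp add: mult_ac)
qed simp

lemma dtft_iter_low: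
  assumes h: "fin_supp h"
  shows "fin_supp (iter_low h j) \<and> dtft (iter_low h j) \<xi> = (\<Prod>k<j. dtft h (2 ^ k * \<xi>))"
proof (induction j)
  case 0
  show ?case
    using dtft_finite[of "{0}" unit_impulse \<xi>] by (simp add: unit_impulse_def[abs_def])
next
  case (Suc j)
  then show ?case
    using dtft_conv[of "iter_low h j" "(upsample ^^ j) h"] dtft_upsample_funpow[OF h, of j]
    by simp
qed

lemma dtft_iter_high:
  assumes h: "fin_supp h" and g: "fin_supp g"
  shows "fin_supp (iter_high h g (Suc j))"
    and "dtft (iter_high h g (Suc j)) \<xi> = (\<Prod>k<j. dtft h (2 ^ k * \<xi>)) * dtft g (2 ^ j * \<xi>)"
  unfolding iter_high_def
  using dtft_conv[of "iter_low h j" "(upsample ^^ j) g"] dtft_upsample_funpow[OF g, of j]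
    dtft_iter_low[OF h, of j]
  by simp_all

lemma dtft_inner_translates:
  assumes x: "fin_supp x" and f: "fin_supp f"
  shows "fin_supp ((downsample ^^ j) (conv x (invol f)))"
    and "dtft ((downsample ^^ j) (conv x (invol f))) \<zeta>
      = (\<Sum>k<2 ^ j. dtft x ((\<zeta> + real k) / 2 ^ j) * cnj (dtft f ((\<zeta> + real k) / 2 ^ j))) / 2 ^ j"
proof -
  have eq: "(downsample ^^ j) z = (\<lambda>k. z (int (2 ^ j) * k))" for z
    by (auto simp: downsample_funpow)
  note c = dtft_conv[OF x dtft_invol(1)[OF f]]
  show "fin_supp ((downsample ^^ j) (conv x (invol f)))"
    unfolding eq by (rule dtft_decimate(1)[OF c(1)]) simp
  show "dtft ((downsample ^^ j) (conv x (invol f))) \<zeta>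
      = (\<Sum>k<2 ^ j. dtft x ((\<zeta> + real k) / 2 ^ j) * cnj (dtft f ((\<zeta> + real k) / 2 ^ j))) / 2 ^ j"
    unfolding eq by (subst dtft_decimate(2)[OF c(1)]) (simp_all add: c(2) dtft_invol(2)[OF f])
qed

section \<open>Trigonometric polynomials\<close>

text \<open>Identifying trigonometric polynomials with transforms of finitely supported sequences turns their
  products into convolutions, which gives the closure properties below.\<close>

lemma trig_poly_iff_dtft: "trig_poly p \<longleftrightarrow> (\<exists>y. fin_supp y \<and> p = dtft y)"
proof
  assume "trig_poly p"
  then obtain S c where S: "finite S" and p: "\<And>\<xi>. p \<xi> = (\<Sum>m\<in>S. c m * character m \<xi>)"
    unfolding trig_poly_def exp_eq_character by blast
  define y where "y m = (if m \<in> S then c m else 0)" for m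
  have "dtft y \<xi> = (\<Sum>m\<in>S. y m * character m \<xi>)" for \<xi> by (rule dtft_finite[OF S]) (simp add: y_def)
  then have "p = dtft y" by (auto simp: p y_def)
  moreover have "fin_supp y" by (rule finite_subset[OF _ S]) (auto simp: y_def)
  ultimately show "\<exists>y. fin_supp y \<and> p = dtft y" by blast
next
  assume "\<exists>y. fin_supp y \<and> p = dtft y"
  then show "trig_poly p" unfolding trig_poly_def exp_eq_character using dtft_fin_supp by blast
qed

lemma trig_poly_mult: "trig_poly p \<Longrightarrow> trig_poly q \<Longrightarrow> trig_poly (\<lambda>\<xi>. p \<xi> * q \<xi>)"
  unfolding trig_poly_iff_dtft using dtft_conv by fastforce

lemma trig_poly_const: "trig_poly (\<lambda>\<xi>. c)"
  unfolding trig_poly_def exp_eq_character by (rule exI[of _ "{0}"]) (auto intro!: exI[of _ "\<lambda>_. c"])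

lemma trig_poly_power: "trig_poly p \<Longrightarrow> trig_poly (\<lambda>\<xi>. p \<xi> ^ n)"
  by (induction n) (simp_all add: trig_poly_const trig_poly_mult)

lemma trig_poly_cosine_factor: "trig_poly (\<lambda>\<xi>. (1 + exp (2 * of_real pi * \<i> * of_real \<xi>)) / 2)"
proof -
  have "exp (2 * of_real pi * \<i> * of_real \<xi>) = character (- 1) \<xi>" for \<xi>
    by (simp add: character_def cis_conv_exp algebra_simps)
  then show ?thesis
    unfolding trig_poly_def exp_eq_character
    by (intro exI[of _ "{0, -1}"] exI[of _ "\<lambda>_. 1/2"]) (simp add: field_simps)
qed

lemma trig_poly_bounded:
  assumes "trig_poly f"
  obtains P where "P \<ge> 1" "\<And>\<xi>. cmod (f \<xi>) \<le> P"
proof -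
  obtain X where X: "\<And>\<xi>. cmod (f \<xi>) \<le> X"
    using assms dtft_bounded unfolding trig_poly_iff_dtft by metis
  show thesis by (rule that[of "max 1 X"]) (use X in \<open>auto simp: le_max_iff_disj\<close>)
qed

text \<open>A nonzero value of the transform certifies that the series converges, so \<open>h\<close> is absolutely summable.
  Subtracting the coefficients of the polynomial from a long truncation of \<open>h\<close> leaves a finitely
  supported sequence whose transform is as small as the tail of \<open>h\<close>; Parseval's identity then bounds
  each of its entries by that tail.\<close>

lemma fin_supp_of_dtft_trig_poly:
  assumes h0: "dtft h 0 \<noteq> 0" and T: "trig_poly (dtft h)"
  shows "fin_supp h"
proof -
  have summ: "h summable_on UNIV"
    using h0 infsum_not_exists[of h UNIV] by (auto simp: dtft_character)
  then have abs: "(\<lambda>n. cmod (h n)) summable_on UNIV"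
    using summable_on_iff_abs_summable_on_complex by blast
  obtain S0 c where S0: "finite S0" and c: "\<And>\<xi>. dtft h \<xi> = (\<Sum>m\<in>S0. c m * character m \<xi>)"
    using T unfolding trig_poly_def exp_eq_character by blast
  have "h m = 0" if m: "m \<notin> S0" for m
  proof (rule ccontr)
    assume hm: "h m \<noteq> 0"
    define \<epsilon> where "\<epsilon> = cmod (h m) / 2"
    have e: "\<epsilon> > 0" using hm by (simp add: \<epsilon>_def)
    have "eventually (\<lambda>F. dist (\<Sum>n\<in>F. cmod (h n)) (\<Sum>\<^sub>\<infinity>n. cmod (h n)) < \<epsilon>) (finite_subsets_at_top UNIV)"
      using tendstoD[OF has_sum_infsum[OF abs, unfolded has_sum_def] e] .
    then obtain S1 where S1: "finite S1" "\<And>F. finite F \<Longrightarrow> S1 \<subseteq> F \<Longrightarrow>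
        dist (\<Sum>n\<in>F. cmod (h n)) (\<Sum>\<^sub>\<infinity>n. cmod (h n)) < \<epsilon>"
      unfolding eventually_finite_subsets_at_top by auto
    define S where "S = insert m (S0 \<union> S1)"
    have fS: "finite S" using S0 S1 by (simp add: S_def)
    define y where "y k = (if k \<in> S then h k - (if k \<in> S0 then c k else 0) else 0)" for k
    have fy: "fin_supp y" by (rule finite_subset[OF _ fS]) (auto simp: y_def)
    have tail: "cmod (dtft y \<xi>) \<le> \<epsilon>" for \<xi>
    proof -
      have s1: "(\<lambda>n. h n * character n \<xi>) summable_on A" for A
        unfolding summable_on_iff_abs_summable_on_complex norm_mult norm_character mult_1_right
        by (rule summable_on_subset_banach[OF abs]) simp
      have "dtft y \<xi> = (\<Sum>n\<in>S. y n * character n \<xi>)"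
        by (rule dtft_finite[OF fS]) (simp add: y_def)
      also have "\<dots> = (\<Sum>n\<in>S. h n * character n \<xi>) - (\<Sum>n\<in>S. if n \<in> S0 then c n * character n \<xi> else 0)"
        unfolding sum_subtractf[symmetric] by (rule sum.cong) (auto simp: y_def algebra_simps)
      also have "(\<Sum>n\<in>S. if n \<in> S0 then c n * character n \<xi> else 0) = (\<Sum>n\<in>S0. c n * character n \<xi>)"
        by (rule sum.mono_neutral_cong_right) (use fS in \<open>auto simp: S_def\<close>)
      also have "\<dots> = dtft h \<xi>" by (simp add: c)
      also have "dtft h \<xi> = (\<Sum>\<^sub>\<infinity>n\<in>S. h n * character n \<xi>) + (\<Sum>\<^sub>\<infinity>n\<in>-S. h n * character n \<xi>)"
        unfolding dtft_character by (subst infsum_Un_disjoint[symmetric]) (use s1 in auto)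
      finally have "cmod (dtft y \<xi>) = cmod (\<Sum>\<^sub>\<infinity>n\<in>-S. h n * character n \<xi>)"
        using fS by simp
      also have "\<dots> \<le> (\<Sum>\<^sub>\<infinity>n\<in>-S. cmod (h n * character n \<xi>))"
        by (rule norm_infsum_bound) (use s1 in \<open>simp add: summable_on_iff_abs_summable_on_complex\<close>)
      also have "\<dots> = (\<Sum>\<^sub>\<infinity>n\<in>-S. cmod (h n))" by (simp add: norm_mult)
      also have "\<dots> = (\<Sum>\<^sub>\<infinity>n. cmod (h n)) - (\<Sum>n\<in>S. cmod (h n))"
        using infsum_Un_disjoint[of "\<lambda>n. cmod (h n)" S "-S"] fS
          summable_on_subset_banach[OF abs, of "-S"] by simp
      also have "\<dots> \<le> \<epsilon>"
        using S1(2)[OF fS] by (simp add: S_def dist_real_def abs_less_iff) fastforce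
      finally show ?thesis .
    qed
    obtain N0 where N0: "\<And>N. N \<ge> N0 \<Longrightarrow> energy y = (\<Sum>r<N. (cmod (dtft y (real r / real N)))\<^sup>2) / real N"
      using parseval[OF fy] unfolding eventually_sequentially by blast
    then have "energy y = (\<Sum>r<Suc N0. (cmod (dtft y (real r / real (Suc N0))))\<^sup>2) / real (Suc N0)"
      by (intro N0) simp
    also have "\<dots> \<le> (\<Sum>r<Suc N0. \<epsilon>\<^sup>2) / real (Suc N0)"
      by (intro divide_right_mono sum_mono power_mono tail) auto
    also have "\<dots> = \<epsilon>\<^sup>2" by simp
    finally have "energy y \<le> \<epsilon>\<^sup>2" .
    moreover have "(cmod (y m))\<^sup>2 \<le> energy y"
      unfolding energy_fin_supp[OF fy]
      by (rule member_le_sum) (use fy hm m in \<open>auto simp: y_def S_def\<close>)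
    ultimately have "(cmod (y m))\<^sup>2 \<le> \<epsilon>\<^sup>2" by simp
    then have "cmod (y m) \<le> \<epsilon>" by (rule power2_le_imp_le) (use e in simp)
    then show False using m hm by (simp add: y_def S_def \<epsilon>_def)
  qed
  then show ?thesis using S0 by (rule_tac finite_subset[OF _ S0]) auto
qed

section \<open>The modulus of sin (pi x)\<close>

text \<open>A substitute for the distance of the frequency to the nearest integer. Its bounds under integer
  dilations hold on the whole line, which avoids reducing the dilated frequencies to a period.\<close>

definition abs_sin_pi :: "real \<Rightarrow> real" where
  "abs_sin_pi \<xi> = \<bar>sin (pi * \<xi>)\<bar>"

lemma abs_sin_pi_nonneg [simp]: "abs_sin_pi \<xi> \<ge> 0" and abs_sin_pi_le_1 [simp]: "abs_sin_pi \<xi> \<le> 1"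
  by (simp_all add: abs_sin_pi_def)

lemma abs_sin_pi_mult_nat: "abs_sin_pi (real m * \<xi>) \<le> real m * abs_sin_pi \<xi>"
proof (induction m)
  case (Suc m)
  have "abs_sin_pi (real (Suc m) * \<xi>) = \<bar>sin (pi * (real m * \<xi>)) * cos (pi * \<xi>) + cos (pi * (real m * \<xi>)) * sin (pi * \<xi>)\<bar>"
    by (simp add: abs_sin_pi_def sin_add algebra_simps)
  also have "\<dots> \<le> \<bar>sin (pi * (real m * \<xi>))\<bar> * \<bar>cos (pi * \<xi>)\<bar> + \<bar>cos (pi * (real m * \<xi>))\<bar> * \<bar>sin (pi * \<xi>)\<bar>"
    unfolding abs_mult[symmetric] by (rule abs_triangle_ineq)
  also have "\<dots> \<le> abs_sin_pi (real m * \<xi>) * 1 + 1 * abs_sin_pi \<xi>"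
    unfolding abs_sin_pi_def by (intro add_mono mult_mono) auto
  finally show ?case using Suc by (simp add: algebra_simps)
qed (simp add: abs_sin_pi_def)

lemma abs_sin_pi_mult_int: "abs_sin_pi (of_int m * \<xi>) \<le> of_int \<bar>m\<bar> * abs_sin_pi \<xi>"
proof -
  have "abs_sin_pi (of_int m * \<xi>) = abs_sin_pi (real (nat \<bar>m\<bar>) * \<xi>)"
    by (cases "m \<ge> 0") (simp_all add: abs_sin_pi_def)
  also have "\<dots> \<le> real (nat \<bar>m\<bar>) * abs_sin_pi \<xi>" by (rule abs_sin_pi_mult_nat)
  finally show ?thesis by simp
qed

lemma abs_sin_pi_pow2: "abs_sin_pi (2 ^ k * \<xi>) \<le> 2 ^ k * abs_sin_pi \<xi>"
  using abs_sin_pi_mult_nat[of "2 ^ k" \<xi>] by simp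

text \<open>Jordan's inequality: on the unit interval the concave function \<open>sin (pi x)\<close> lies above the tent with
  its vertices at \<open>0\<close>, \<open>1/2\<close> and \<open>1\<close>.\<close>

lemma abs_sin_pi_lower:
  assumes "0 \<le> \<xi>" "\<xi> \<le> 1"
  shows "2 * min \<xi> (1 - \<xi>) \<le> abs_sin_pi \<xi>"
proof -
  have cvx: "convex_on {0..1} (\<lambda>x. - sin (pi * x))"
  proof (rule f''_ge0_imp_convex)
    show "((\<lambda>x. - sin (pi * x)) has_real_derivative - pi * cos (pi * x)) (at x)" for x
      by (auto intro!: derivative_eq_intros)
    show "((\<lambda>x. - pi * cos (pi * x)) has_real_derivative pi\<^sup>2 * sin (pi * x)) (at x)" for x
      by (auto intro!: derivative_eq_intros simp: power2_eq_square)
    show "0 \<le> pi\<^sup>2 * sin (pi * x)" if "x \<in> {0..1}" for x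
      using that by (intro mult_nonneg_nonneg sin_ge_zero) auto
  qed simp
  have half: "2 * x \<le> sin (pi * x)" if "0 \<le> x" "x \<le> 1/2" for x :: real
  proof -
    have "- sin (pi * ((1 - 2 * x) *\<^sub>R 0 + (2 * x) *\<^sub>R (1/2))) \<le> (1 - 2 * x) * (- sin (pi * 0)) + (2 * x) * (- sin (pi * (1/2)))"
      by (rule convex_onD[OF cvx]) (use that in auto)
    then show ?thesis by simp
  qed
  have sym: "sin (pi * \<xi>) = sin (pi * (1 - \<xi>))"
    by (simp add: right_diff_distrib)
  show ?thesis
  proof (cases "\<xi> \<le> 1/2")
    case True
    then show ?thesis using half[of \<xi>] assms by (simp add: abs_sin_pi_def)
  next
    case False
    then show ?thesis using half[of "1 - \<xi>"] assms sym by (simp add: abs_sin_pi_def)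
  qed
qed

lemma norm_character_minus_1: "cmod (character m \<xi> - 1) = 2 * abs_sin_pi (of_int m * \<xi>)"
proof -
  define a where "a = pi * (of_int m * \<xi>)"
  have c: "character m \<xi> = cis (- (2 * a))" by (simp add: character_def a_def mult_ac)
  have "(cmod (character m \<xi> - 1))\<^sup>2 = (cos (2 * a) - 1)\<^sup>2 + (sin (2 * a))\<^sup>2"
    by (simp add: c cmod_power2)
  also have "\<dots> = 2 - 2 * cos (2 * a)"
    using sin_cos_squared_add[of "2 * a"] by (simp add: power2_eq_square algebra_simps)
  also have "\<dots> = (2 * sin a)\<^sup>2"
    by (simp add: cos_double_sin power2_eq_square)
  finally have "(cmod (character m \<xi> - 1))\<^sup>2 = (2 * abs_sin_pi (of_int m * \<xi>))\<^sup>2"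
    by (simp add: abs_sin_pi_def a_def power_mult_distrib)
  then show ?thesis by (rule power2_eq_imp_eq) auto
qed

lemma trig_poly_lipschitz_at_0:
  assumes "trig_poly f"
  obtains L where "L \<ge> 0" "\<And>\<xi>. cmod (f \<xi> - f 0) \<le> L * abs_sin_pi \<xi>"
proof -
  obtain S c where S: "finite S" and f: "\<And>\<xi>. f \<xi> = (\<Sum>m\<in>S. c m * character m \<xi>)"
    using assms unfolding trig_poly_def exp_eq_character by blast
  have "cmod (f \<xi> - f 0) \<le> (\<Sum>m\<in>S. cmod (c m) * (2 * of_int \<bar>m\<bar>)) * abs_sin_pi \<xi>" for \<xi>
  proof -
    have "f \<xi> - f 0 = (\<Sum>m\<in>S. c m * (character m \<xi> - 1))"
      by (simp add: f sum_subtractf algebra_simps)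
    also have "cmod \<dots> \<le> (\<Sum>m\<in>S. cmod (c m) * (2 * of_int \<bar>m\<bar> * abs_sin_pi \<xi>))"
      by (rule sum_norm_le) (use abs_sin_pi_mult_int in \<open>simp add: norm_mult norm_character_minus_1 mult_left_mono mult.assoc\<close>)
    finally show ?thesis by (simp add: sum_distrib_right mult.assoc)
  qed
  moreover have "(\<Sum>m\<in>S. cmod (c m) * (2 * of_int \<bar>m\<bar>)) \<ge> 0"
    by (intro sum_nonneg) simp
  ultimately show thesis using that by blast
qed

section \<open>Growth of the dilated products\<close>

lemma norm_cosine_factor: "cmod ((1 + exp (2 * of_real pi * \<i> * of_real \<xi>)) / 2) = \<bar>cos (pi * \<xi>)\<bar>"
proof -
  define a where "a = pi * \<xi>"
  have "1 + exp (2 * of_real pi * \<i> * of_real \<xi>) = 1 + cis (2 * a)"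
    by (simp add: cis_conv_exp a_def mult_ac)
  moreover have "(cmod (1 + cis (2 * a)))\<^sup>2 = (2 * cos a)\<^sup>2"
  proof -
    have "(cmod (1 + cis (2 * a)))\<^sup>2 = (1 + cos (2 * a))\<^sup>2 + (sin (2 * a))\<^sup>2"
      by (simp add: cmod_power2)
    also have "\<dots> = 2 + 2 * cos (2 * a)"
      using sin_cos_squared_add[of "2 * a"] by (simp add: power2_eq_square algebra_simps)
    also have "\<dots> = (2 * cos a)\<^sup>2"
      unfolding cos_double_cos by (simp add: power_mult_distrib)
    finally show ?thesis .
  qed
  then have "(cmod (1 + cis (2 * a)))\<^sup>2 = (2 * \<bar>cos a\<bar>)\<^sup>2" by (simp add: power_mult_distrib)
  then have "cmod (1 + cis (2 * a)) = 2 * \<bar>cos a\<bar>" by (rule power2_eq_imp_eq) auto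
  ultimately show ?thesis by (simp add: norm_divide a_def)
qed

text \<open>The doubling formula \<open>sin (2 x) = 2 sin x cos x\<close> makes the product collapse.\<close>

lemma prod_cos_telescope: "abs_sin_pi \<xi> * 2 ^ J * (\<Prod>k<J. \<bar>cos (pi * (2 ^ k * \<xi>))\<bar>) = abs_sin_pi (2 ^ J * \<xi>)"
proof (induction J)
  case (Suc J)
  have "abs_sin_pi (2 ^ Suc J * \<xi>) = 2 * abs_sin_pi (2 ^ J * \<xi>) * \<bar>cos (pi * (2 ^ J * \<xi>))\<bar>"
    using sin_double[of "pi * (2 ^ J * \<xi>)"] by (simp add: abs_sin_pi_def abs_mult mult_ac)
  then show ?case using Suc by (simp add: mult_ac)
qed simp

lemma prod_cos_le: "(\<Prod>k<J. \<bar>cos (pi * (2 ^ k * \<xi>))\<bar>) \<le> 1 / max 1 (2 ^ J * abs_sin_pi \<xi>)"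
proof -
  have "(\<Prod>k<J. \<bar>cos (pi * (2 ^ k * \<xi>))\<bar>) \<le> 1" by (intro prod_le_1) auto
  moreover have "(2 ^ J * abs_sin_pi \<xi>) * (\<Prod>k<J. \<bar>cos (pi * (2 ^ k * \<xi>))\<bar>) \<le> 1"
    using prod_cos_telescope[of \<xi> J] abs_sin_pi_le_1[of "2 ^ J * \<xi>"] by (simp add: mult_ac)
  ultimately show ?thesis by (auto simp: max_def pos_le_divide_eq mult.commute)
qed

lemma prod_lessThan_add:
  "(\<Prod>k<a + b. f k) = (\<Prod>k<a. f k) * (\<Prod>k<b. f (a + k))" for f :: "nat \<Rightarrow> 'a::comm_monoid_mult"
  by (induction b) (simp_all add: mult_ac)

text \<open>Cutting the product into blocks of length \<open>s\<close>, each block costs \<open>2 powr (\<beta> s)\<close>; the incomplete last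
  block has fewer than \<open>s\<close> factors, each at most \<open>P\<close>.\<close>

lemma prod_dilates_growth:
  fixes p :: "real \<Rightarrow> complex"
  assumes P: "P \<ge> 1" "\<And>\<xi>. cmod (p \<xi>) \<le> P" and s: "s \<ge> 1" and \<beta>: "\<beta> \<ge> 0"
    and ps: "\<And>\<xi>. cmod (\<Prod>k<s. p (2 ^ k * \<xi>)) \<le> 2 powr (\<beta> * real s)"
  shows "cmod (\<Prod>k<J. p (2 ^ k * \<xi>)) \<le> P ^ s * 2 powr (\<beta> * real J)"
proof (induction J arbitrary: \<xi> rule: less_induct)
  case (less J)
  show ?case
  proof (cases "J < s")
    case True
    have "cmod (\<Prod>k<J. p (2 ^ k * \<xi>)) \<le> (\<Prod>k<J. P)"
      unfolding prod_norm[symmetric] by (rule prod_mono) (use P in auto)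
    also have "\<dots> \<le> P ^ s * 1" using True P by (simp add: power_increasing)
    also have "\<dots> \<le> P ^ s * 2 powr (\<beta> * real J)"
      using P \<beta> by (intro mult_left_mono ge_one_powr_ge_zero) auto
    finally show ?thesis .
  next
    case False
    define I where "I = J - s"
    have J: "J = s + I" using False by (simp add: I_def)
    have "(\<Prod>k<J. p (2 ^ k * \<xi>)) = (\<Prod>k<s. p (2 ^ k * \<xi>)) * (\<Prod>k<I. p (2 ^ k * (2 ^ s * \<xi>)))"
      unfolding J prod_lessThan_add by (simp add: power_add mult_ac)
    also have "cmod \<dots> \<le> 2 powr (\<beta> * real s) * (P ^ s * 2 powr (\<beta> * real I))"
      unfolding norm_mult by (rule mult_mono[OF ps less]) (use s J in auto)
    also have "\<dots> = P ^ s * 2 powr (\<beta> * real J)"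
      by (simp add: J powr_add[symmetric] algebra_simps)
    finally show ?thesis .
  qed
qed

text \<open>As long as \<open>2^m \<sigma> \<le> 1\<close>, the errors \<open>L 2^k \<sigma>\<close> of the factors form a geometric sum that is bounded by
  \<open>L\<close>, independently of \<open>m\<close>.\<close>

lemma prod_dilates_near_0:
  fixes p :: "real \<Rightarrow> complex"
  assumes L: "L \<ge> 0" "\<And>\<xi>. cmod (p \<xi> - 1) \<le> L * abs_sin_pi \<xi>" and m: "2 ^ m * abs_sin_pi \<xi> \<le> 1"
  shows "cmod (\<Prod>k<m. p (2 ^ k * \<xi>)) \<le> exp L"
proof -
  have "cmod (\<Prod>k<m. p (2 ^ k * \<xi>)) \<le> (\<Prod>k<m. exp (L * 2 ^ k * abs_sin_pi \<xi>))"
    unfolding prod_norm[symmetric]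
  proof (rule prod_mono, safe)
    fix k
    have "cmod (p (2 ^ k * \<xi>)) \<le> 1 + cmod (p (2 ^ k * \<xi>) - 1)"
      using norm_triangle_ineq[of 1 "p (2 ^ k * \<xi>) - 1"] by simp
    also have "\<dots> \<le> 1 + L * (2 ^ k * abs_sin_pi \<xi>)"
      using L(2)[of "2 ^ k * \<xi>"] mult_left_mono[OF abs_sin_pi_pow2 L(1), of k \<xi>] by linarith
    also have "\<dots> \<le> exp (L * (2 ^ k * abs_sin_pi \<xi>))" by (rule exp_ge_add_one_self)
    finally show "cmod (p (2 ^ k * \<xi>)) \<le> exp (L * 2 ^ k * abs_sin_pi \<xi>)" by (simp add: mult.assoc)
  qed simp
  also have "\<dots> = exp (L * abs_sin_pi \<xi> * (\<Sum>k<m. 2 ^ k))"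
    by (simp add: exp_sum[symmetric] sum_distrib_left mult_ac)
  also have "(\<Sum>k<m. 2 ^ k) = (2 ^ m - 1 :: real)" by (simp add: sum_gp_strict)
  also have "exp (L * abs_sin_pi \<xi> * (2 ^ m - 1)) \<le> exp (L * 1)"
  proof -
    have "abs_sin_pi \<xi> * (2 ^ m - 1) = 2 ^ m * abs_sin_pi \<xi> - abs_sin_pi \<xi>" by (simp add: algebra_simps)
    then have "abs_sin_pi \<xi> * (2 ^ m - 1) \<le> 1" using m abs_sin_pi_nonneg[of \<xi>] by linarith
    then have "L * (abs_sin_pi \<xi> * (2 ^ m - 1)) \<le> L * 1" using L(1) by (rule mult_left_mono)
    then show ?thesis by (simp add: mult.assoc)
  qed
  finally show ?thesis by simp
qed

text \<open>The product is cut at the last index \<open>m\<close> with \<open>2^m \<sigma> \<le> 1\<close>. The factors before the cut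
  contribute a constant, and the \<open>J - m\<close> factors behind it contribute \<open>2^((J - m) \<beta>)\<close>, where
  \<open>2^(J - m)\<close> is comparable to \<open>2^J \<sigma>\<close>.\<close>

lemma prod_dilates_le:
  fixes p :: "real \<Rightarrow> complex"
  assumes P: "P \<ge> 1" "\<And>\<xi>. cmod (p \<xi>) \<le> P" and s: "s \<ge> 1" and \<beta>: "\<beta> \<ge> 0"
    and ps: "\<And>\<xi>. cmod (\<Prod>k<s. p (2 ^ k * \<xi>)) \<le> 2 powr (\<beta> * real s)"
    and L: "L \<ge> 0" "\<And>\<xi>. cmod (p \<xi> - 1) \<le> L * abs_sin_pi \<xi>"
  shows "cmod (\<Prod>k<J. p (2 ^ k * \<xi>)) \<le> exp L * P ^ s * 2 powr \<beta> * max 1 (2 ^ J * abs_sin_pi \<xi>) powr \<beta>"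
proof -
  have one: "1 \<le> P ^ s" using P by simp
  have two: "1 \<le> 2 powr \<beta>" using \<beta> by (simp add: ge_one_powr_ge_zero)
  show ?thesis
  proof (cases "2 ^ J * abs_sin_pi \<xi> \<le> 1")
    case True
    have "cmod (\<Prod>k<J. p (2 ^ k * \<xi>)) \<le> exp L * 1 * 1"
      using prod_dilates_near_0[OF L True] by simp
    also have "\<dots> \<le> exp L * P ^ s * 2 powr \<beta>"
      using one two by (intro mult_mono) auto
    finally show ?thesis using True by simp
  next
    case False
    \<comment> \<open>The cut at which \<open>2^m \<sigma>\<close> is about to exceed \<open>1\<close>.\<close>
    define m where "m = (LEAST i. 2 ^ Suc i * abs_sin_pi \<xi> > 1)"
    have J0: "J \<noteq> 0" using False abs_sin_pi_le_1[of \<xi>] by (intro notI) (simp del: abs_sin_pi_le_1)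
    then obtain J' where J': "J = Suc J'" using not0_implies_Suc by blast
    have m1: "2 ^ Suc m * abs_sin_pi \<xi> > 1"
      unfolding m_def by (rule LeastI[of _ J']) (use False J' in simp)
    have m2: "m \<le> J'" unfolding m_def by (rule Least_le) (use False J' in simp)
    have m3: "2 ^ m * abs_sin_pi \<xi> \<le> 1"
    proof (cases m)
      case (Suc i)
      then have "\<not> 2 ^ Suc i * abs_sin_pi \<xi> > 1"
        unfolding m_def using not_less_Least[of i "\<lambda>i. 2 ^ Suc i * abs_sin_pi \<xi> > 1"] by simp
      then show ?thesis using Suc by simp
    qed simp
    define I where "I = J - m"
    have J: "J = m + I" using m2 J' by (simp add: I_def)
    have "(\<Prod>k<J. p (2 ^ k * \<xi>)) = (\<Prod>k<m. p (2 ^ k * \<xi>)) * (\<Prod>k<I. p (2 ^ k * (2 ^ m * \<xi>)))"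
      unfolding J prod_lessThan_add by (simp add: power_add mult_ac)
    also have "cmod \<dots> \<le> exp L * (P ^ s * 2 powr (\<beta> * real I))"
      unfolding norm_mult
      by (rule mult_mono[OF prod_dilates_near_0[OF L m3] prod_dilates_growth[OF P s \<beta> ps]]) auto
    also have "2 powr (\<beta> * real I) = (2 ^ I) powr \<beta>"
      by (simp add: powr_powr powr_realpow[symmetric] mult.commute)
    also have "(2 ^ I :: real) powr \<beta> \<le> (2 * (2 ^ J * abs_sin_pi \<xi>)) powr \<beta>"
    proof (rule powr_mono2[OF \<beta>])
      have "2 ^ I * 1 \<le> 2 ^ I * (2 ^ Suc m * abs_sin_pi \<xi>)" using m1 by (intro mult_left_mono) auto
      then show "2 ^ I \<le> 2 * (2 ^ J * abs_sin_pi \<xi>)" by (simp add: J power_add mult_ac)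
    qed simp
    also have "\<dots> = 2 powr \<beta> * max 1 (2 ^ J * abs_sin_pi \<xi>) powr \<beta>"
      using False by (simp add: powr_mult max_def)
    finally show ?thesis using P by (simp add: mult_ac)
  qed
qed

section \<open>Weights\<close>

text \<open>The argument stands for \<open>2^J \<sigma>\<close>. The decay \<open>-(1 + 3 \<delta>)\<close> of the squared symbol is shared out:
  \<open>-(1 + \<delta>)\<close> is what makes a sum over a dyadic coset converge, and \<open>-2 \<delta>\<close>
  is left over to be summed over the levels.\<close>

definition coset_weight :: "real \<Rightarrow> real \<Rightarrow> real" where
  "coset_weight \<delta> t = max 1 t powr (- (1 + \<delta>))"

definition level_weight :: "real \<Rightarrow> real \<Rightarrow> real" where
  "level_weight \<delta> t = max 1 t powr (- 2 * \<delta>)"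

lemma coset_weight_nonneg [simp]: "coset_weight \<delta> t \<ge> 0" and level_weight_nonneg [simp]: "level_weight \<delta> t \<ge> 0"
  by (simp_all add: coset_weight_def level_weight_def)

lemma coset_weight_antimono: "\<delta> > 0 \<Longrightarrow> t \<le> u \<Longrightarrow> coset_weight \<delta> u \<le> coset_weight \<delta> t"
  unfolding coset_weight_def by (rule powr_mono2') auto

text \<open>The cosine factors give \<open>max(1, 2^J \<sigma>)^(-n)\<close> and the dilates of \<open>p\<close> grow with exponent
  \<open>\<beta> = n - (1 + 3 \<delta>) / 2\<close>, so the modulus decays with exponent \<open>(1 + 3 \<delta>) / 2\<close>.\<close>

lemma low_pass_product_bound:
  assumes p: "trig_poly p" "p 0 = 1" and s: "s \<ge> 1"
    and ps: "\<And>\<xi>. cmod (\<Prod>k<s. p (2 ^ k * \<xi>)) \<le> 2 powr ((real n - (1 + 3 * \<delta>) / 2) * real s)"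
    and \<beta>: "(1 + 3 * \<delta>) / 2 \<le> real n"
    and H: "\<And>\<xi>. H \<xi> = of_real (sqrt 2) * ((1 + exp (2 * of_real pi * \<i> * of_real \<xi>)) / 2) ^ n * p \<xi>"
  obtains C where "C \<ge> 0"
    "\<And>J \<xi>. (cmod (\<Prod>k<J. H (2 ^ k * \<xi>)))\<^sup>2 \<le> C * 2 ^ J * (coset_weight \<delta> (2 ^ J * abs_sin_pi \<xi>) * level_weight \<delta> (2 ^ J * abs_sin_pi \<xi>))"
proof -
  define \<beta> where "\<beta> = real n - (1 + 3 * \<delta>) / 2"
  have b0: "\<beta> \<ge> 0" using \<beta> by (simp add: \<beta>_def)
  obtain P where P: "P \<ge> 1" "\<And>\<xi>. cmod (p \<xi>) \<le> P" using trig_poly_bounded[OF p(1)] by blast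
  obtain L where L: "L \<ge> 0" "\<And>\<xi>. cmod (p \<xi> - 1) \<le> L * abs_sin_pi \<xi>"
    using trig_poly_lipschitz_at_0[OF p(1)] p(2) by metis
  define C where "C = (exp L * P ^ s * 2 powr \<beta>)"
  have C0: "C \<ge> 0" using P by (simp add: C_def)
  have "(cmod (\<Prod>k<J. H (2 ^ k * \<xi>)))\<^sup>2 \<le> C\<^sup>2 * 2 ^ J * (coset_weight \<delta> (2 ^ J * abs_sin_pi \<xi>) * level_weight \<delta> (2 ^ J * abs_sin_pi \<xi>))" for J \<xi>
  proof -
    define t where "t = max 1 (2 ^ J * abs_sin_pi \<xi>)"
    have t: "t \<ge> 1" by (simp add: t_def)
    have "cmod (\<Prod>k<J. H (2 ^ k * \<xi>))
       = (\<Prod>k<J. sqrt 2 * \<bar>cos (pi * (2 ^ k * \<xi>))\<bar> ^ n * cmod (p (2 ^ k * \<xi>)))"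
      unfolding prod_norm[symmetric] H norm_mult norm_power norm_cosine_factor by simp
    also have "\<dots> = sqrt 2 ^ J * (\<Prod>k<J. \<bar>cos (pi * (2 ^ k * \<xi>))\<bar>) ^ n * cmod (\<Prod>k<J. p (2 ^ k * \<xi>))"
      by (simp add: prod.distrib prod_norm prod_power_distrib)
    also have "\<dots> \<le> sqrt 2 ^ J * (1 / t) ^ n * (C * t powr \<beta>)"
      using prod_cos_le[where J = J and \<xi> = \<xi>]
        prod_dilates_le[OF P s b0 ps[folded \<beta>_def] L, where J = J and \<xi> = \<xi>]
      by (intro mult_mono power_mono) (auto simp: t_def C_def intro!: prod_nonneg mult_nonneg_nonneg zero_le_power)
    also have "\<dots> = sqrt 2 ^ J * (C * t powr (\<beta> - real n))"
      using t by (simp add: powr_diff powr_realpow field_simps)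
    finally have "(cmod (\<Prod>k<J. H (2 ^ k * \<xi>)))\<^sup>2 \<le> (sqrt 2 ^ J * (C * t powr (\<beta> - real n)))\<^sup>2"
      by (rule power_mono) simp
    also have "\<dots> = C\<^sup>2 * 2 ^ J * (t powr (\<beta> - real n))\<^sup>2"
      by (simp add: power_mult_distrib power_mult[symmetric] mult.commute[of J 2])
         (simp add: power_mult)
    also have "(t powr (\<beta> - real n))\<^sup>2 = t powr (- (1 + \<delta>)) * t powr (- 2 * \<delta>)"
      unfolding power2_eq_square powr_add[symmetric]
      by (rule arg_cong[where f = "\<lambda>a. t powr a"]) (simp add: \<beta>_def)
    finally show ?thesis by (simp add: coset_weight_def level_weight_def t_def)
  qed
  then show thesis using that[of "C\<^sup>2"] by simp
qed

text \<open>For the \<open>k\<close>-th point of the coset, Jordan's inequality bounds the argument of the weight from below by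
  the distance of \<open>k\<close> to the two ends \<open>0\<close> and \<open>M - 1\<close>. The sum is thus at most twice the convergent
  series of the \<open>k powr (-(1 + \<delta>))\<close>, whatever \<open>M\<close> is.\<close>

lemma coset_sum_bounded:
  assumes "\<delta> > 0"
  obtains K where "K \<ge> 0" "\<And>M \<zeta>. M > 0 \<Longrightarrow> 0 \<le> \<zeta> \<Longrightarrow> \<zeta> < 1 \<Longrightarrow>
    (\<Sum>k<M. coset_weight \<delta> (real M / 2 * abs_sin_pi ((\<zeta> + real k) / real M))) \<le> K"
proof -
  have "summable (\<lambda>k. real (Suc k) powr (- (1 + \<delta>)))"
    using assms summable_real_powr_iff[of "- (1 + \<delta>)"]
      summable_Suc_iff[of "\<lambda>k. real k powr (- (1 + \<delta>))"] by simp
  moreover have "coset_weight \<delta> (real (Suc k)) = real (Suc k) powr (- (1 + \<delta>))" for k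
    by (simp add: coset_weight_def)
  ultimately have "summable (\<lambda>k. coset_weight \<delta> (real (Suc k)))" by presburger
  then have sm: "summable (\<lambda>k. coset_weight \<delta> (real k))" by (rule summable_Suc_iff[THEN iffD1])
  define K where "K = suminf (\<lambda>k. coset_weight \<delta> (real k))"
  have K: "(\<Sum>k<M. coset_weight \<delta> (real k)) \<le> K" for M
    unfolding K_def by (rule sum_le_suminf[OF sm]) auto
  have "(\<Sum>k<M. coset_weight \<delta> (real M / 2 * abs_sin_pi ((\<zeta> + real k) / real M))) \<le> 2 * K"
    if M: "M > 0" and z: "0 \<le> \<zeta>" "\<zeta> < 1" for M \<zeta>
  proof -
    have "coset_weight \<delta> (real M / 2 * abs_sin_pi ((\<zeta> + real k) / real M)) \<le> coset_weight \<delta> (real k) + coset_weight \<delta> (real (M - Suc k))"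
      if k: "k < M" for k
    proof -
      define \<xi> where "\<xi> = (\<zeta> + real k) / real M"
      have xi: "0 \<le> \<xi>" "\<xi> \<le> 1" using z k by (simp_all add: \<xi>_def field_simps)
      have Mx: "real M * \<xi> = \<zeta> + real k" using M by (simp add: \<xi>_def)
      have "min (real k) (real (M - Suc k)) \<le> min (real M * \<xi>) (real M * (1 - \<xi>))"
        using z k by (intro min.mono) (auto simp: Mx right_diff_distrib of_nat_diff)
      also have "\<dots> = real M / 2 * (2 * min \<xi> (1 - \<xi>))"
        using min_mult_distrib_left[of "real M" \<xi> "1 - \<xi>"] by simp
      also have "\<dots> \<le> real M / 2 * abs_sin_pi \<xi>"
        by (intro mult_left_mono abs_sin_pi_lower xi) simp
      finally have "coset_weight \<delta> (real M / 2 * abs_sin_pi \<xi>) \<le> coset_weight \<delta> (min (real k) (real (M - Suc k)))"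
        by (rule coset_weight_antimono[OF assms])
      also have "\<dots> \<le> coset_weight \<delta> (real k) + coset_weight \<delta> (real (M - Suc k))"
        by (simp add: min_def)
      finally show ?thesis by (simp add: \<xi>_def)
    qed
    then have "(\<Sum>k<M. coset_weight \<delta> (real M / 2 * abs_sin_pi ((\<zeta> + real k) / real M)))
        \<le> (\<Sum>k<M. coset_weight \<delta> (real k) + coset_weight \<delta> (real (M - Suc k)))"
      by (intro sum_mono) auto
    also have "\<dots> = 2 * (\<Sum>k<M. coset_weight \<delta> (real k))"
      unfolding sum.distrib sum.nat_diff_reindex[of "\<lambda>k. coset_weight \<delta> (real k)"] by simp
    finally show ?thesis using K[of M] by simp
  qed
  moreover have "K \<ge> 0" using K[of 0] by simp
  ultimately show thesis using that[of "2 * K"] by simp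
qed

text \<open>Below \<open>2^i t = 1\<close> the terms grow geometrically and above it they decay geometrically. The bounded
  potential \<open>\<Psi>\<close> in the proof packs both geometric sums into one telescoping estimate.\<close>

lemma dyadic_sum_bounded:
  assumes "\<delta> > 0"
  obtains B where "B \<ge> 0" "\<And>J t. t \<ge> 0 \<Longrightarrow> (\<Sum>i<J. level_weight \<delta> (2 ^ i * t) * (min 1 (2 ^ i * t))\<^sup>2) \<le> B"
proof -
  \<comment> \<open>The sum of the geometric series with ratio \<open>2 powr (- 2 \<delta>)\<close>, which governs the levels with \<open>2^i t > 1\<close>.\<close>
  define K where "K = 1 / (1 - 2 powr (- 2 * \<delta>))"
  have lt1: "2 powr (- 2 * \<delta>) < 1" using assms powr_less_mono[of "- 2 * \<delta>" 0 2] by simp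
  have pos: "1 - 2 powr (- 2 * \<delta>) > 0" using lt1 by linarith
  then have K: "K \<ge> 0" unfolding K_def by (intro divide_nonneg_pos) auto
  have K': "K * (1 - 2 powr (- 2 * \<delta>)) = 1"
    unfolding K_def by (rule nonzero_eq_divide_eq[THEN iffD1, OF _ refl]) (use pos in linarith)
  define \<Psi> where "\<Psi> t = min 4 (t\<^sup>2) / 3 + K * (1 - level_weight \<delta> t)" for t :: real
  have wb1: "level_weight \<delta> t \<le> 1" for t
    unfolding level_weight_def using assms powr_mono2'[of "- 2 * \<delta>" 1 "max 1 t"] by simp
  have step: "level_weight \<delta> t * (min 1 t)\<^sup>2 \<le> \<Psi> (2 * t) - \<Psi> t" if "t \<ge> 0" for t
  proof (cases "t \<le> 1")
    case True
    have t2: "t\<^sup>2 \<le> 1" using True that by (simp add: power_le_one)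
    have "K * (1 - level_weight \<delta> (2 * t)) \<ge> 0" using K wb1[of "2 * t"] by simp
    then show ?thesis using True t2 by (simp add: \<Psi>_def level_weight_def power_mult_distrib min_def)
  next
    case False
    have w: "level_weight \<delta> (2 * t) = 2 powr (- 2 * \<delta>) * level_weight \<delta> t"
      using False by (simp add: level_weight_def powr_mult)
    have "K * (1 - level_weight \<delta> (2 * t)) - K * (1 - level_weight \<delta> t) = (K * (1 - 2 powr (- 2 * \<delta>))) * level_weight \<delta> t"
      unfolding w by (simp add: algebra_simps)
    then have "K * (1 - level_weight \<delta> (2 * t)) - K * (1 - level_weight \<delta> t) = level_weight \<delta> t"
      by (simp only: K' mult_1)
    moreover have "min 4 (t\<^sup>2) \<le> min 4 ((2 * t)\<^sup>2)" by (simp add: power_mult_distrib min_def)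
    ultimately show ?thesis using False by (simp add: \<Psi>_def)
  qed
  have "(\<Sum>i<J. level_weight \<delta> (2 ^ i * t) * (min 1 (2 ^ i * t))\<^sup>2) \<le> 4 / 3 + K" if t: "t \<ge> 0" for J t
  proof -
    have "(\<Sum>i<J. level_weight \<delta> (2 ^ i * t) * (min 1 (2 ^ i * t))\<^sup>2) \<le> (\<Sum>i<J. \<Psi> (2 ^ Suc i * t) - \<Psi> (2 ^ i * t))"
      using step[of "2 ^ _ * t"] t by (intro sum_mono) (simp add: mult.assoc)
    also have "\<dots> = \<Psi> (2 ^ J * t) - \<Psi> t"
      using sum_lessThan_telescope[of "\<lambda>i. \<Psi> (2 ^ i * t)" J] by simp
    also have "\<dots> \<le> 4 / 3 + K"
    proof -
      have "K * (1 - level_weight \<delta> (2 ^ J * t)) \<le> K * 1" using K by (intro mult_left_mono) auto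
      moreover have "K * (1 - level_weight \<delta> t) \<ge> 0" using K wb1 by simp
      moreover have "min 4 ((2 ^ J * t)\<^sup>2) \<le> 4" "min 4 (t\<^sup>2) \<ge> 0" by simp_all
      ultimately show ?thesis unfolding \<Psi>_def by linarith
    qed
    finally show ?thesis .
  qed
  then show thesis using that[of "4 / 3 + K"] K by simp
qed

definition low_pass_decay :: "(int \<Rightarrow> complex) \<Rightarrow> real \<Rightarrow> bool" where
  "low_pass_decay h \<delta> \<longleftrightarrow> (\<exists>C\<ge>0. \<forall>J \<xi>. (cmod (\<Prod>k<J. dtft h (2 ^ k * \<xi>)))\<^sup>2
      \<le> C * 2 ^ J * (coset_weight \<delta> (2 ^ J * abs_sin_pi \<xi>) * level_weight \<delta> (2 ^ J * abs_sin_pi \<xi>)))"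

section \<open>Weighted Cauchy-Schwarz over dyadic cosets\<close>

lemma sum_lessThan_mult:
  "(\<Sum>r<M * N. f r) = (\<Sum>k<M. \<Sum>q<N. f (k * N + q))" for f :: "nat \<Rightarrow> 'a::comm_monoid_add"
proof (induction M)
  case (Suc M)
  have split: "(\<Sum>r<a + b. f r) = (\<Sum>r<a. f r) + (\<Sum>q<b. f (a + q))" for a b
    by (induction b) (simp_all add: add.assoc)
  show ?case using split[of "M * N" N] Suc by (simp add: add.commute)
qed simp

text \<open>The grid of the \<open>M N\<close>-th roots of unity, sorted by the \<open>N\<close>-th root of unity that is the
  \<open>M\<close>-th power of a point.\<close>

lemma sum_grid_cosets:
  fixes F :: "real \<Rightarrow> 'a::comm_monoid_add"
  assumes "M > 0" "N > 0"
  shows "(\<Sum>r<M * N. F (real r / real (M * N))) = (\<Sum>q<N. \<Sum>k<M. F ((real q / real N + real k) / real M))"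
proof -
  have "(real k * real N + real q) / (real M * real N) = (real q / real N + real k) / real M" for k q
    using assms by (simp add: field_simps)
  then show ?thesis
    by (subst sum_lessThan_mult, subst sum.swap) simp
qed

text \<open>By the aliasing formula, each value of the transform of \<open>y\<close> is an average over a coset of \<open>2^J\<close>
  frequencies. Cauchy-Schwarz separates the factor \<open>d\<close>, whose sum over the coset is at most \<open>K\<close>, from
  the spectrum of \<open>x\<close> weighted with \<open>b\<close>. The averages over the cosets then combine to one average
  over the finer grid.\<close>

lemma energy_translates_le:
  assumes x: "fin_supp x" and f: "fin_supp f" and C: "C \<ge> 0"
    and b: "\<And>\<xi>. b \<xi> \<ge> 0" and d: "\<And>\<xi>. d \<xi> \<ge> 0"
    and fb: "\<And>\<xi>. (cmod (dtft f \<xi>))\<^sup>2 \<le> C * 2 ^ J * (d \<xi> * b \<xi>)"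
    and K: "\<And>\<zeta>. 0 \<le> \<zeta> \<Longrightarrow> \<zeta> < 1 \<Longrightarrow> (\<Sum>k<2 ^ J. d ((\<zeta> + real k) / 2 ^ J)) \<le> K"
    and y: "y = (downsample ^^ J) (conv x (invol f))"
    and N: "N > 0" and par: "energy y = (\<Sum>q<N. (cmod (dtft y (real q / real N)))\<^sup>2) / real N"
  shows "energy y \<le> C * K * ((\<Sum>r<2 ^ J * N. (cmod (dtft x (real r / real (2 ^ J * N))))\<^sup>2
      * b (real r / real (2 ^ J * N))) / real (2 ^ J * N))"
proof -
  define G where "G \<xi> = (cmod (dtft x \<xi>))\<^sup>2 * b \<xi>" for \<xi>
  have pt: "(cmod (dtft y \<zeta>))\<^sup>2 \<le> C * K / 2 ^ J * (\<Sum>k<2 ^ J. G ((\<zeta> + real k) / 2 ^ J))"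
    if z: "0 \<le> \<zeta>" "\<zeta> < 1" for \<zeta>
  proof -
    define \<xi> where "\<xi> k = (\<zeta> + real k) / 2 ^ J" for k
    have "cmod (dtft y \<zeta>) = cmod (\<Sum>k<2 ^ J. dtft x (\<xi> k) * cnj (dtft f (\<xi> k))) / 2 ^ J"
      unfolding y dtft_inner_translates(2)[OF x f] \<xi>_def by (simp add: norm_divide norm_power)
    also have "cmod (\<Sum>k<2 ^ J. dtft x (\<xi> k) * cnj (dtft f (\<xi> k)))
        \<le> (\<Sum>k<2 ^ J. (cmod (dtft x (\<xi> k)) * sqrt (b (\<xi> k))) * (sqrt (C * 2 ^ J) * sqrt (d (\<xi> k))))"
    proof (rule sum_norm_le)
      fix k
      have "cmod (dtft f (\<xi> k)) \<le> sqrt (C * 2 ^ J * (d (\<xi> k) * b (\<xi> k)))"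
        using fb[of "\<xi> k"] by (simp add: real_le_rsqrt)
      also have "\<dots> = sqrt (b (\<xi> k)) * (sqrt (C * 2 ^ J) * sqrt (d (\<xi> k)))"
        by (simp add: real_sqrt_mult mult_ac)
      finally have "cmod (dtft x (\<xi> k)) * cmod (dtft f (\<xi> k))
          \<le> cmod (dtft x (\<xi> k)) * (sqrt (b (\<xi> k)) * (sqrt (C * 2 ^ J) * sqrt (d (\<xi> k))))"
        by (rule mult_left_mono) simp
      then show "cmod (dtft x (\<xi> k) * cnj (dtft f (\<xi> k)))
          \<le> (cmod (dtft x (\<xi> k)) * sqrt (b (\<xi> k))) * (sqrt (C * 2 ^ J) * sqrt (d (\<xi> k)))"
        by (simp add: norm_mult mult.assoc)
    qed
    finally have "(cmod (dtft y \<zeta>))\<^sup>2 \<le> ((\<Sum>k<2 ^ J. (cmod (dtft x (\<xi> k)) * sqrt (b (\<xi> k))) * (sqrt (C * 2 ^ J) * sqrt (d (\<xi> k)))) / 2 ^ J)\<^sup>2"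
      by (intro power_mono) (auto simp: divide_right_mono)
    also have "\<dots> = (\<Sum>k<2 ^ J. (cmod (dtft x (\<xi> k)) * sqrt (b (\<xi> k))) * (sqrt (C * 2 ^ J) * sqrt (d (\<xi> k))))\<^sup>2 / (2 ^ J)\<^sup>2"
      by (rule power_divide)
    also have "\<dots> \<le> ((\<Sum>k<2 ^ J. (cmod (dtft x (\<xi> k)) * sqrt (b (\<xi> k)))\<^sup>2)
        * (\<Sum>k<2 ^ J. (sqrt (C * 2 ^ J) * sqrt (d (\<xi> k)))\<^sup>2)) / (2 ^ J)\<^sup>2"
      by (intro divide_right_mono Cauchy_Schwarz_ineq_sum) simp
    also have "(\<Sum>k<2 ^ J. (cmod (dtft x (\<xi> k)) * sqrt (b (\<xi> k)))\<^sup>2) = (\<Sum>k<2 ^ J. G (\<xi> k))"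
      by (simp add: G_def power_mult_distrib b)
    also have "(\<Sum>k<2 ^ J. (sqrt (C * 2 ^ J) * sqrt (d (\<xi> k)))\<^sup>2) = C * 2 ^ J * (\<Sum>k<2 ^ J. d (\<xi> k))"
      using C by (simp add: power_mult_distrib d sum_distrib_left)
    also have "(\<Sum>k<2 ^ J. G (\<xi> k)) * (C * 2 ^ J * (\<Sum>k<2 ^ J. d (\<xi> k))) / (2 ^ J)\<^sup>2
        \<le> (\<Sum>k<2 ^ J. G (\<xi> k)) * (C * 2 ^ J * K) / (2 ^ J)\<^sup>2"
      using C K[OF z] b unfolding \<xi>_def G_def
      by (intro divide_right_mono mult_left_mono sum_nonneg) auto
    also have "\<dots> = C * K / 2 ^ J * (\<Sum>k<2 ^ J. G (\<xi> k))"
      by (simp add: power2_eq_square field_simps)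
    finally show ?thesis by (simp add: \<xi>_def)
  qed
  have "energy y \<le> (\<Sum>q<N. C * K / 2 ^ J * (\<Sum>k<2 ^ J. G ((real q / real N + real k) / 2 ^ J))) / real N"
    unfolding par by (intro divide_right_mono sum_mono pt) (use N in auto)
  also have "\<dots> = C * K * ((\<Sum>q<N. \<Sum>k<2 ^ J. G ((real q / real N + real k) / real (2 ^ J))) / real (2 ^ J * N))"
    unfolding sum_distrib_left[symmetric] by (simp add: mult_ac)
  also have "(\<Sum>q<N. \<Sum>k<2 ^ J. G ((real q / real N + real k) / real (2 ^ J)))
      = (\<Sum>r<2 ^ J * N. G (real r / real (2 ^ J * N)))"
    by (rule sum_grid_cosets[symmetric]) (use N in auto)
  finally show ?thesis unfolding G_def .
qed

section \<open>Decay of the approximation coefficients and the Bessel bound\<close>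

text \<open>The low-pass branch after \<open>J\<close> levels, that is, the part of \<open>x\<close> that the details of levels \<open>1\<close> to \<open>J\<close>
  have not yet captured.\<close>

definition approx :: "(int \<Rightarrow> complex) \<Rightarrow> nat \<Rightarrow> (int \<Rightarrow> complex) \<Rightarrow> int \<Rightarrow> complex" where
  "approx h J x = (downsample ^^ J) (conv x (invol (iter_low h J)))"

lemma approx_0: "approx h 0 x = x"
proof
  fix k
  have "conv x (invol unit_impulse) k = (\<Sum>n\<in>{0}. invol unit_impulse n * x (k - n))"
    unfolding conv_def by (rule infsum_eq_sum) (auto simp: invol_def unit_impulse_def)
  then show "approx h 0 x k = x k"
    by (simp add: approx_def invol_def unit_impulse_def)
qed

text \<open>The spectrum of \<open>x\<close> is bounded, so it suffices to average the remaining weight over the grid. Since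
  \<open>2^J \<sigma> \<le> 2^J\<close>, trading the exponent \<open>-2 \<delta>\<close> for \<open>-(1 + \<delta>)\<close> costs a factor \<open>2^(J (1 - \<delta>))\<close>,
  while the average of the latter weight is of order \<open>2^(-J)\<close> by the coset estimate.\<close>

lemma approx_energy_decay:
  assumes h: "fin_supp h" and \<delta>: "\<delta> > 0" "\<delta> < 1" and lb: "low_pass_decay h \<delta>" and x: "fin_supp x"
  obtains D where "\<And>J. energy (approx h J x) \<le> D * (2 powr (- \<delta>)) ^ J"
proof -
  obtain C where C: "C \<ge> 0" and hC: "\<And>J \<xi>. (cmod (\<Prod>k<J. dtft h (2 ^ k * \<xi>)))\<^sup>2
      \<le> C * 2 ^ J * (coset_weight \<delta> (2 ^ J * abs_sin_pi \<xi>) * level_weight \<delta> (2 ^ J * abs_sin_pi \<xi>))"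
    using lb unfolding low_pass_decay_def by blast
  obtain K where K0: "K \<ge> 0" and K: "\<And>M \<zeta>. M > 0 \<Longrightarrow> 0 \<le> \<zeta> \<Longrightarrow> \<zeta> < 1 \<Longrightarrow>
    (\<Sum>k<M. coset_weight \<delta> (real M / 2 * abs_sin_pi ((\<zeta> + real k) / real M))) \<le> K"
    using coset_sum_bounded[OF \<delta>(1)] by blast
  obtain X where X: "\<And>\<xi>. cmod (dtft x \<xi>) \<le> X" using dtft_bounded[OF x] by blast
  have level_weight_le: "level_weight \<delta> (2 ^ J * abs_sin_pi \<xi>) \<le> coset_weight \<delta> (2 ^ J / 2 * abs_sin_pi \<xi>) * (2 ^ J) powr (1 - \<delta>)" for J \<xi>
  proof -
    define t where "t = max 1 (2 ^ J * abs_sin_pi \<xi>)"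
    have t: "1 \<le> t" "t \<le> 2 ^ J" by (auto simp: t_def mult_left_le)
    have "level_weight \<delta> (2 ^ J * abs_sin_pi \<xi>) = t powr (- (1 + \<delta>)) * t powr (1 - \<delta>)"
      unfolding powr_add[symmetric] level_weight_def t_def by (rule arg_cong2[where f = "(powr)"]) simp_all
    also have "\<dots> \<le> coset_weight \<delta> (2 ^ J / 2 * abs_sin_pi \<xi>) * (2 ^ J) powr (1 - \<delta>)"
      using t \<delta> coset_weight_antimono[OF \<delta>(1), of "2 ^ J / 2 * abs_sin_pi \<xi>" "2 ^ J * abs_sin_pi \<xi>"]
      by (intro mult_mono powr_mono2) (auto simp: coset_weight_def t_def)
    finally show ?thesis .
  qed
  have "energy (approx h J x) \<le> (C * K * X\<^sup>2 * K) * (2 powr (- \<delta>)) ^ J" for J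
  proof -
    note il = dtft_iter_low[OF h, of J]
    have f: "fin_supp (iter_low h J)" using il by blast
    have fa: "fin_supp (approx h J x)" unfolding approx_def by (rule dtft_inner_translates(1)[OF x f])
    obtain N0 where N0: "\<And>N. N \<ge> N0 \<Longrightarrow> energy (approx h J x)
        = (\<Sum>r<N. (cmod (dtft (approx h J x) (real r / real N)))\<^sup>2) / real N"
      using parseval[OF fa] unfolding eventually_sequentially by blast
    define N where "N = Suc N0"
    define w where "w = (2 ^ J :: real) powr (1 - \<delta>)"
    have Ksum: "(\<Sum>k<2 ^ J. coset_weight \<delta> (2 ^ J / 2 * abs_sin_pi ((\<zeta> + real k) / 2 ^ J))) \<le> K"
      if "0 \<le> \<zeta>" "\<zeta> < 1" for \<zeta> using K[of "2 ^ J" \<zeta>] that by simp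
    have "energy (approx h J x) \<le> C * K * ((\<Sum>r<2 ^ J * N. (cmod (dtft x (real r / real (2 ^ J * N))))\<^sup>2
      * level_weight \<delta> (2 ^ J * abs_sin_pi (real r / real (2 ^ J * N)))) / real (2 ^ J * N))"
    proof (rule energy_translates_le[OF x f C, where b = "\<lambda>\<xi>. level_weight \<delta> (2 ^ J * abs_sin_pi \<xi>)"
          and d = "\<lambda>\<xi>. coset_weight \<delta> (2 ^ J / 2 * abs_sin_pi \<xi>)"])
      show "(cmod (dtft (iter_low h J) \<xi>))\<^sup>2 \<le> C * 2 ^ J * (coset_weight \<delta> (2 ^ J / 2 * abs_sin_pi \<xi>) * level_weight \<delta> (2 ^ J * abs_sin_pi \<xi>))" for \<xi>
      proof -
        have "(cmod (dtft (iter_low h J) \<xi>))\<^sup>2 \<le> C * 2 ^ J * (coset_weight \<delta> (2 ^ J * abs_sin_pi \<xi>) * level_weight \<delta> (2 ^ J * abs_sin_pi \<xi>))"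
          using hC[where J = J and \<xi> = \<xi>] dtft_iter_low[OF h, of J \<xi>] by simp
        also have "\<dots> \<le> C * 2 ^ J * (coset_weight \<delta> (2 ^ J / 2 * abs_sin_pi \<xi>) * level_weight \<delta> (2 ^ J * abs_sin_pi \<xi>))"
          by (intro mult_left_mono mult_right_mono coset_weight_antimono[OF \<delta>(1)]) (use C in auto)
        finally show ?thesis .
      qed
      show "energy (approx h J x) = (\<Sum>q<N. (cmod (dtft (approx h J x) (real q / real N)))\<^sup>2) / real N"
        by (rule N0) (simp add: N_def)
    qed (use Ksum in \<open>auto simp: approx_def N_def\<close>)
    also have "\<dots> \<le> C * K * ((\<Sum>r<2 ^ J * N. X\<^sup>2 * (coset_weight \<delta> (2 ^ J / 2 * abs_sin_pi (real r / real (2 ^ J * N))) * w)) / real (2 ^ J * N))"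
      unfolding w_def
      by (intro mult_left_mono divide_right_mono sum_mono mult_mono power_mono X level_weight_le mult_nonneg_nonneg C K0)
        auto
    also have "\<dots> = C * K * X\<^sup>2 * w * ((\<Sum>r<2 ^ J * N. coset_weight \<delta> (2 ^ J / 2 * abs_sin_pi (real r / real (2 ^ J * N)))) / real (2 ^ J * N))"
      by (simp add: sum_distrib_left sum_distrib_right sum_divide_distrib mult_ac)
    also have "(\<Sum>r<2 ^ J * N. coset_weight \<delta> (2 ^ J / 2 * abs_sin_pi (real r / real (2 ^ J * N))))
        = (\<Sum>q<N. \<Sum>k<2 ^ J. coset_weight \<delta> (2 ^ J / 2 * abs_sin_pi ((real q / real N + real k) / real (2 ^ J))))"
      by (rule sum_grid_cosets) (auto simp: N_def)
    also have "\<dots> \<le> (\<Sum>q<N. K)"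
      by (rule sum_mono) (use Ksum in \<open>simp add: N_def\<close>)
    also have "C * K * X\<^sup>2 * w * ((\<Sum>q<N. K) / real (2 ^ J * N)) = (C * K * X\<^sup>2 * K) * (w / 2 ^ J)"
    proof -
      have "N > 0" by (simp add: N_def)
      then show ?thesis by (simp add: field_simps)
    qed
    also have "w / 2 ^ J = (2 powr (- \<delta>)) ^ J"
    proof -
      have "w = 2 powr (real J * (1 - \<delta>))"
        by (simp add: w_def powr_realpow[symmetric] powr_powr)
      then have "w / 2 ^ J = 2 powr (real J * (1 - \<delta>) - real J)"
        by (simp add: powr_diff powr_realpow)
      moreover have "(2 powr (- \<delta>)) ^ J = 2 powr (- \<delta> * real J)"
        by (subst powr_realpow[symmetric]) (simp, simp only: powr_powr)
      ultimately show ?thesis by (simp add: algebra_simps)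
    qed
    finally show ?thesis using C K0 by (simp add: w_def divide_right_mono mult_left_mono)
  qed
  then show thesis using that by blast
qed

text \<open>The high-pass symbol vanishes at \<open>0\<close> and hence contributes \<open>min(1, 2^j \<sigma>)^2\<close> at level \<open>j + 1\<close>. With
  all levels sampled on one common grid, the sum over the levels can be taken pointwise in the
  spectrum of \<open>x\<close>.\<close>

lemma detail_energy_sum_le:
  assumes h: "fin_supp h" and g: "fin_supp g" "dtft g 0 = 0" and \<delta>: "\<delta> > 0" and lb: "low_pass_decay h \<delta>"
  obtains B where "B \<ge> 0"
    "\<And>x J. fin_supp x \<Longrightarrow> (\<Sum>j<J. energy (analysis h g (Suc j) x)) \<le> B * energy x"
proof -
  obtain C where C: "C \<ge> 0" and hC: "\<And>J \<xi>. (cmod (\<Prod>k<J. dtft h (2 ^ k * \<xi>)))\<^sup>2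
      \<le> C * 2 ^ J * (coset_weight \<delta> (2 ^ J * abs_sin_pi \<xi>) * level_weight \<delta> (2 ^ J * abs_sin_pi \<xi>))"
    using lb unfolding low_pass_decay_def by blast
  obtain K where K0: "K \<ge> 0" and K: "\<And>M \<zeta>. M > 0 \<Longrightarrow> 0 \<le> \<zeta> \<Longrightarrow> \<zeta> < 1 \<Longrightarrow>
    (\<Sum>k<M. coset_weight \<delta> (real M / 2 * abs_sin_pi ((\<zeta> + real k) / real M))) \<le> K"
    using coset_sum_bounded[OF \<delta>(1)] by blast
  obtain S where S0: "S \<ge> 0"
    and S: "\<And>J t. t \<ge> 0 \<Longrightarrow> (\<Sum>i<J. level_weight \<delta> (2 ^ i * t) * (min 1 (2 ^ i * t))\<^sup>2) \<le> S"
    using dyadic_sum_bounded[OF \<delta>(1)] by blast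
  have "trig_poly (dtft g)"
    unfolding trig_poly_iff_dtft using g(1) by blast
  then obtain L where L: "L \<ge> 0" "\<And>\<xi>. cmod (dtft g \<xi>) \<le> L * abs_sin_pi \<xi>"
    using trig_poly_lipschitz_at_0[of "dtft g"] g(2) by auto
  define b where "b j \<xi> = level_weight \<delta> (2 ^ j * abs_sin_pi \<xi>) * (min 1 (2 ^ j * abs_sin_pi \<xi>))\<^sup>2" for j \<xi>
  have b0: "b j \<xi> \<ge> 0" for j \<xi> by (simp add: b_def)
  have fb: "(cmod (dtft (iter_high h g (Suc j)) \<xi>))\<^sup>2
      \<le> C * L\<^sup>2 * 2 ^ Suc j * (coset_weight \<delta> (2 ^ Suc j / 2 * abs_sin_pi \<xi>) * b j \<xi>)" for j \<xi>
  proof -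
    have "cmod (dtft g (2 ^ j * \<xi>)) \<le> L * min 1 (2 ^ j * abs_sin_pi \<xi>)"
      using L(2)[of "2 ^ j * \<xi>"] mult_left_mono[OF _ L(1), of "abs_sin_pi (2 ^ j * \<xi>)" "min 1 (2 ^ j * abs_sin_pi \<xi>)"]
        abs_sin_pi_pow2[of j \<xi>] by force
    then have "(cmod (dtft g (2 ^ j * \<xi>)))\<^sup>2 \<le> (L * min 1 (2 ^ j * abs_sin_pi \<xi>))\<^sup>2"
      by (rule power_mono) simp
    then have "(cmod (dtft (iter_high h g (Suc j)) \<xi>))\<^sup>2
      \<le> (C * 2 ^ j * (coset_weight \<delta> (2 ^ j * abs_sin_pi \<xi>) * level_weight \<delta> (2 ^ j * abs_sin_pi \<xi>))) * (L * min 1 (2 ^ j * abs_sin_pi \<xi>))\<^sup>2"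
      unfolding dtft_iter_high(2)[OF h g(1)] norm_mult power_mult_distrib[of "cmod _"]
      using C by (intro mult_mono hC) auto
    also have "\<dots> = C * L\<^sup>2 * 2 ^ j * (coset_weight \<delta> (2 ^ Suc j / 2 * abs_sin_pi \<xi>) * b j \<xi>)"
      by (simp add: b_def power_mult_distrib mult_ac)
    also have "\<dots> \<le> C * L\<^sup>2 * 2 ^ Suc j * (coset_weight \<delta> (2 ^ Suc j / 2 * abs_sin_pi \<xi>) * b j \<xi>)"
      using C b0 by (intro mult_right_mono mult_left_mono) auto
    finally show ?thesis .
  qed
  have "(\<Sum>j<J. energy (analysis h g (Suc j) x)) \<le> (C * L\<^sup>2 * K * S) * energy x" if x: "fin_supp x" for x J
  proof -
    have fa: "fin_supp (analysis h g (Suc j) x)" for j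
      unfolding analysis_def by (rule dtft_inner_translates(1)[OF x dtft_iter_high(1)[OF h g(1)]])
    have "eventually (\<lambda>N. \<forall>j\<in>{..<J}. energy (analysis h g (Suc j) x)
        = (\<Sum>r<N. (cmod (dtft (analysis h g (Suc j) x) (real r / real N)))\<^sup>2) / real N) sequentially"
      by (intro eventually_ball_finite ballI parseval fa) simp
    from eventually_conj[OF this parseval[OF x]]
    obtain N0 where N0: "\<And>N j. N \<ge> N0 \<Longrightarrow> j < J \<Longrightarrow> energy (analysis h g (Suc j) x)
        = (\<Sum>r<N. (cmod (dtft (analysis h g (Suc j) x) (real r / real N)))\<^sup>2) / real N"
      and N0x: "\<And>N. N \<ge> N0 \<Longrightarrow> energy x = (\<Sum>r<N. (cmod (dtft x (real r / real N)))\<^sup>2) / real N"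
      unfolding eventually_sequentially by auto
    define N where "N = 2 ^ J * Suc N0"
    define X where "X r = (cmod (dtft x (real r / real N)))\<^sup>2" for r
    have each: "energy (analysis h g (Suc j) x)
        \<le> C * L\<^sup>2 * K * ((\<Sum>r<N. X r * b j (real r / real N)) / real N)" if j: "j < J" for j
    proof -
      \<comment> \<open>Level \<open>j + 1\<close> is sampled on the grid of size \<open>N'\<close>, so that its cosets fill the common grid of size \<open>N\<close>.\<close>
      define N' where "N' = 2 ^ (J - Suc j) * Suc N0"
      have pw: "2 ^ Suc j * 2 ^ (J - Suc j) = (2 ^ J :: nat)"
        using j by (metis Suc_leI le_add_diff_inverse power_add)
      then have N: "N = 2 ^ Suc j * N'" unfolding N_def N'_def by (simp only: mult.assoc[symmetric])
      have big: "N' \<ge> N0" unfolding N'_def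
        by (rule order_trans[of _ "1 * Suc N0"]) (auto intro!: mult_right_mono simp del: mult_Suc_right)
      show ?thesis unfolding X_def N
      proof (rule energy_translates_le[OF x dtft_iter_high(1)[OF h g(1), of j], where b = "b j"
            and d = "\<lambda>\<xi>. coset_weight \<delta> (2 ^ Suc j / 2 * abs_sin_pi \<xi>)"])
        show "(\<Sum>k<2 ^ Suc j. coset_weight \<delta> (2 ^ Suc j / 2 * abs_sin_pi ((\<zeta> + real k) / 2 ^ Suc j))) \<le> K"
          if "0 \<le> \<zeta>" "\<zeta> < 1" for \<zeta> using K[of "2 ^ Suc j" \<zeta>] that by simp
        show "energy (analysis h g (Suc j) x)
            = (\<Sum>q<N'. (cmod (dtft (analysis h g (Suc j) x) (real q / real N')))\<^sup>2) / real N'"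
          by (rule N0[OF big j])
        show "(cmod (dtft (iter_high h g (Suc j)) \<xi>))\<^sup>2
          \<le> C * L\<^sup>2 * 2 ^ Suc j * (coset_weight \<delta> (2 ^ Suc j / 2 * abs_sin_pi \<xi>) * b j \<xi>)" for \<xi> by (rule fb)
      qed (use b0 C in \<open>auto simp: analysis_def N'_def\<close>)
    qed
    have "(\<Sum>j<J. energy (analysis h g (Suc j) x))
        \<le> (\<Sum>j<J. C * L\<^sup>2 * K * ((\<Sum>r<N. X r * b j (real r / real N)) / real N))"
      by (rule sum_mono) (use each in auto)
    also have "\<dots> = C * L\<^sup>2 * K * ((\<Sum>j<J. \<Sum>r<N. X r * b j (real r / real N)) / real N)"
      by (simp add: sum_distrib_left[symmetric] sum_divide_distrib[symmetric])
    also have "(\<Sum>j<J. \<Sum>r<N. X r * b j (real r / real N)) = (\<Sum>r<N. X r * (\<Sum>j<J. b j (real r / real N)))"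
      by (subst sum.swap) (simp add: sum_distrib_left)
    also have "C * L\<^sup>2 * K * ((\<Sum>r<N. X r * (\<Sum>j<J. b j (real r / real N))) / real N)
        \<le> C * L\<^sup>2 * K * ((\<Sum>r<N. X r * S) / real N)"
      using S[OF abs_sin_pi_nonneg] C K0 unfolding b_def X_def
      by (intro mult_left_mono divide_right_mono sum_mono) auto
    also have "\<dots> = (C * L\<^sup>2 * K * S) * ((\<Sum>r<N. X r) / real N)"
      by (simp add: sum_distrib_right[symmetric])
    also have "(\<Sum>r<N. X r) / real N = energy x"
      unfolding X_def
    proof (rule N0x[symmetric])
      have "1 * N0 \<le> 2 ^ J * Suc N0" by (rule mult_mono) auto
      then show "N0 \<le> N" by (simp only: N_def mult_1)
    qed
    finally show ?thesis .
  qed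
  then show thesis using that[of "C * L\<^sup>2 * K * S"] C K0 S0 by simp
qed

section \<open>One level of the cascade\<close>

text \<open>The expansion inequality at a single frequency, with the factor \<open>1 / sqrt 2\<close> of the modulation matrix
  cleared and the vector written in coordinates.\<close>

definition expanding_at :: "(int \<Rightarrow> complex) \<Rightarrow> (int \<Rightarrow> complex) \<Rightarrow> real \<Rightarrow> bool" where
  "expanding_at h g \<xi> \<longleftrightarrow> (\<forall>a b. 2 * ((cmod a)\<^sup>2 + (cmod b)\<^sup>2)
     \<le> (cmod (dtft g \<xi> * a + dtft h \<xi> * b))\<^sup>2
       + (cmod (dtft g (\<xi> + 1/2) * a + dtft h (\<xi> + 1/2) * b))\<^sup>2)"

text \<open>For a fixed vector both sides are continuous in the frequency, so the inequality holds on a closed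
  set; a closed set that contains almost all points of an open interval contains all of them.\<close>

lemma expanding_everywhere:
  assumes h: "fin_supp h" and g: "fin_supp g" and M: "expanding_ae (modulation_matrix h g)"
    and \<xi>: "\<xi> \<in> {-1/2<..<1/2}"
  shows "expanding_at h g \<xi>"
  unfolding expanding_at_def
proof safe
  fix a b :: complex
  define F where "F \<xi> = (cmod (dtft g \<xi> * a + dtft h \<xi> * b))\<^sup>2
       + (cmod (dtft g (\<xi> + 1/2) * a + dtft h (\<xi> + 1/2) * b))\<^sup>2" for \<xi>
  have nrm: "(norm (v :: complex^2))\<^sup>2 = (cmod (v $ 1))\<^sup>2 + (cmod (v $ 2))\<^sup>2" for v
    by (simp add: norm_vec_def L2_set_def sum_2 sum_nonneg)
  have key: "2 * ((cmod a)\<^sup>2 + (cmod b)\<^sup>2) \<le> F \<xi>"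
    if "norm (modulation_matrix h g \<xi> *v vector [a, b]) \<ge> norm (vector [a, b] :: complex^2)" for \<xi>
  proof -
    have "(norm (vector [a, b] :: complex^2))\<^sup>2 \<le> (norm (modulation_matrix h g \<xi> *v vector [a, b]))\<^sup>2"
      using that by (rule power_mono) simp
    moreover have "(norm (modulation_matrix h g \<xi> *v vector [a, b]))\<^sup>2 = F \<xi> / 2"
    proof -
      have "modulation_matrix h g \<xi> *v vector [a, b]
          = (1 / sqrt 2) *\<^sub>R (vector [dtft g \<xi> * a + dtft h \<xi> * b,
              dtft g (\<xi> + 1/2) * a + dtft h (\<xi> + 1/2) * b] :: complex^2)"
        by (simp add: vec_eq_iff forall_2 modulation_matrix_def matrix_vector_mult_def sum_2 scaleR_add_right)
      then show ?thesis
        by (simp add: power_mult_distrib power_divide nrm F_def)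
    qed
    ultimately show ?thesis by (simp add: nrm)
  qed
  have cont: "continuous_on UNIV F"
    unfolding F_def
    by (intro continuous_intros continuous_on_compose2[OF dtft_continuous[OF g]]
        continuous_on_compose2[OF dtft_continuous[OF h]]) auto
  have "AE x in lebesgue. x \<in> {-1/2..<1/2} \<longrightarrow> (\<forall>c :: complex^2. norm (modulation_matrix h g x *v c) \<ge> norm c)"
    using M unfolding expanding_ae_def by (subst (asm) AE_restrict_space_iff) auto
  then have "AE x \<in> {-1/2<..<1/2} in lebesgue. x \<in> {x. 2 * ((cmod a)\<^sup>2 + (cmod b)\<^sup>2) \<le> F x}"
    by (rule AE_mp, intro AE_I2 impI CollectI key) auto
  then have "\<xi> \<in> {x. 2 * ((cmod a)\<^sup>2 + (cmod b)\<^sup>2) \<le> F x}"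
    by (rule mem_closed_if_AE_lebesgue_open[rotated 2]) (use \<xi> cont in \<open>auto intro!: closed_Collect_le\<close>)
  then show "2 * ((cmod a)\<^sup>2 + (cmod b)\<^sup>2) \<le> (cmod (dtft g \<xi> * a + dtft h \<xi> * b))\<^sup>2
       + (cmod (dtft g (\<xi> + 1/2) * a + dtft h (\<xi> + 1/2) * b))\<^sup>2"
    by (simp add: F_def)
qed

text \<open>An expanding square matrix \<open>M\<close> is invertible, so \<open>w = M c\<close> for some \<open>c\<close> with \<open>norm c \<le> norm w\<close>. Pairing
  \<open>w\<close> with itself moves the adjoint to the other side, and Cauchy-Schwarz gives
  \<open>(norm w)^2 \<le> norm (adjoint M w) * norm c\<close>. The factor \<open>2\<close> is the normalisation of the modulation
  matrix.\<close>

lemma adjoint_expanding: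
  fixes g0 g1 h0 h1 :: complex
  assumes M: "\<And>a b. 2 * ((cmod a)\<^sup>2 + (cmod b)\<^sup>2) \<le> (cmod (g0 * a + h0 * b))\<^sup>2 + (cmod (g1 * a + h1 * b))\<^sup>2"
  shows "2 * ((cmod w0)\<^sup>2 + (cmod w1)\<^sup>2)
    \<le> (cmod (w0 * cnj g0 + w1 * cnj g1))\<^sup>2 + (cmod (w0 * cnj h0 + w1 * cnj h1))\<^sup>2"
proof -
  define \<Delta> where "\<Delta> = g0 * h1 - h0 * g1"
  have D: "\<Delta> \<noteq> 0"
  proof
    assume "\<Delta> = 0"
    then have e: "g0 * h1 = h0 * g1" by (simp add: \<Delta>_def)
    have "2 * ((cmod h1)\<^sup>2 + (cmod g1)\<^sup>2) \<le> 0" using M[of h1 "- g1"] e by (simp add: mult.commute)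
    moreover have "2 * ((cmod h0)\<^sup>2 + (cmod g0)\<^sup>2) \<le> 0" using M[of h0 "- g0"] e by (simp add: mult.commute)
    ultimately have "g0 = 0" "g1 = 0"
      by (smt (verit) zero_le_power2 zero_eq_power2 norm_eq_zero)+
    then show False using M[of 1 0] by simp
  qed
  \<comment> \<open>Cramer's rule for the preimage of \<open>w\<close>.\<close>
  define a where "a = (h1 * w0 - h0 * w1) / \<Delta>"
  define b where "b = (g0 * w1 - g1 * w0) / \<Delta>"
  have w0: "g0 * a + h0 * b = w0"
  proof -
    have "g0 * a + h0 * b = (w0 * \<Delta>) / \<Delta>"
      unfolding a_def b_def times_divide_eq_right add_divide_distrib[symmetric]
      by (simp add: \<Delta>_def algebra_simps)
    then show ?thesis using D by simp
  qed
  have w1: "g1 * a + h1 * b = w1"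
  proof -
    have "g1 * a + h1 * b = (w1 * \<Delta>) / \<Delta>"
      unfolding a_def b_def times_divide_eq_right add_divide_distrib[symmetric]
      by (simp add: \<Delta>_def algebra_simps)
    then show ?thesis using D by simp
  qed
  define u where "u = w0 * cnj g0 + w1 * cnj g1"
  define v where "v = w0 * cnj h0 + w1 * cnj h1"
  define W where "W = (cmod w0)\<^sup>2 + (cmod w1)\<^sup>2"
  have W0: "W \<ge> 0" by (simp add: W_def)
  have "complex_of_real W = w0 * cnj w0 + w1 * cnj w1"
    unfolding W_def of_real_add complex_norm_square ..
  also have "\<dots> = w0 * cnj (g0 * a + h0 * b) + w1 * cnj (g1 * a + h1 * b)" by (simp only: w0 w1)
  also have "\<dots> = u * cnj a + v * cnj b" by (simp add: u_def v_def algebra_simps)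
  finally have "W = cmod (u * cnj a + v * cnj b)" using W0 by (metis norm_of_real abs_of_nonneg)
  also have "\<dots> \<le> cmod u * cmod a + cmod v * cmod b"
    by (rule order_trans[OF norm_triangle_ineq]) (simp add: norm_mult)
  finally have "W\<^sup>2 \<le> (cmod u * cmod a + cmod v * cmod b)\<^sup>2" using W0 by (intro power_mono)
  also have "\<dots> \<le> ((cmod u)\<^sup>2 + (cmod v)\<^sup>2) * ((cmod a)\<^sup>2 + (cmod b)\<^sup>2)"
    using zero_le_power2[of "cmod u * cmod b - cmod v * cmod a"] by (simp add: power2_eq_square algebra_simps)
  also have "\<dots> \<le> ((cmod u)\<^sup>2 + (cmod v)\<^sup>2) * (W / 2)"
    using M[of a b] by (intro mult_left_mono) (simp_all add: w0 w1 W_def)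
  finally have "2 * W * W \<le> ((cmod u)\<^sup>2 + (cmod v)\<^sup>2) * W" by (simp add: power2_eq_square)
  then have "2 * W \<le> (cmod u)\<^sup>2 + (cmod v)\<^sup>2"
    using W0 by (cases "W = 0") (auto simp: mult_le_cancel_right)
  then show ?thesis by (simp add: W_def u_def v_def)
qed

text \<open>The step from level \<open>J\<close> to level \<open>J + 1\<close>, for an arbitrary next filter \<open>f\<close>: the sum over
  \<open>2^(J + 1)\<close> frequencies is split by the parity of the index, and since \<open>f\<close> enters through a function
  of period \<open>1\<close>, it factors out of each half and leaves the level-\<open>J\<close> transform at \<open>\<zeta> / 2\<close> or
  at \<open>\<zeta> / 2 + 1 / 2\<close>.\<close>

lemma dtft_next_level:
  assumes h: "fin_supp h" and f: "fin_supp f" and x: "fin_supp x"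
    and y: "y = (downsample ^^ Suc J) (conv x (invol (conv (iter_low h J) ((upsample ^^ J) f))))"
  shows "fin_supp y"
    and "dtft y \<zeta> = (dtft (approx h J x) (\<zeta> / 2) * cnj (dtft f (\<zeta> / 2))
      + dtft (approx h J x) (\<zeta> / 2 + 1/2) * cnj (dtft f (\<zeta> / 2 + 1/2))) / 2"
proof -
  have il: "fin_supp (iter_low h J)" using dtft_iter_low[OF h] by blast
  have up: "fin_supp ((upsample ^^ J) f)" using dtft_upsample_funpow[OF f] by blast
  have F: "dtft (conv (iter_low h J) ((upsample ^^ J) f)) \<xi> = dtft (iter_low h J) \<xi> * dtft f (2 ^ J * \<xi>)" for \<xi>
    using dtft_conv(2)[OF il up] dtft_upsample_funpow[OF f, of J \<xi>] by simp
  note inner = dtft_inner_translates[OF x dtft_conv(1)[OF il up], of "Suc J"]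
  show "fin_supp y" unfolding y by (rule inner(1))
  define \<Phi> where "\<Phi> \<eta> = dtft x \<eta> * cnj (dtft (iter_low h J) \<eta>)" for \<eta>
  have A: "dtft (approx h J x) \<eta> = (\<Sum>k<2 ^ J. \<Phi> ((\<eta> + real k) / 2 ^ J)) / 2 ^ J" for \<eta>
    unfolding approx_def \<Phi>_def by (rule dtft_inner_translates(2)[OF x il])
  have per: "dtft f (\<eta> + real l) = dtft f \<eta>" for \<eta> l
    using dtft_add_int[of f \<eta> "int l"] by simp
  have arg: "(\<zeta> + real (l * 2 + e)) / 2 ^ Suc J = ((\<zeta> / 2 + real e / 2) + real l) / 2 ^ J" for l e
    by (simp add: field_simps)
  have "dtft y \<zeta> = (\<Sum>k<2 ^ J * 2. \<Phi> ((\<zeta> + real k) / 2 ^ Suc J) * cnj (dtft f (2 ^ J * ((\<zeta> + real k) / 2 ^ Suc J)))) / 2 ^ Suc J"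
    unfolding y inner(2) F by (simp add: \<Phi>_def mult_ac)
  also have "(\<Sum>k<2 ^ J * 2. \<Phi> ((\<zeta> + real k) / 2 ^ Suc J) * cnj (dtft f (2 ^ J * ((\<zeta> + real k) / 2 ^ Suc J))))
      = (\<Sum>l<2 ^ J. \<Sum>e<2. \<Phi> (((\<zeta> / 2 + real e / 2) + real l) / 2 ^ J) * cnj (dtft f ((\<zeta> / 2 + real e / 2) + real l)))"
    unfolding sum_lessThan_mult arg by simp
  also have "\<dots> = (\<Sum>e<2. (\<Sum>l<2 ^ J. \<Phi> (((\<zeta> / 2 + real e / 2) + real l) / 2 ^ J)) * cnj (dtft f (\<zeta> / 2 + real e / 2)))"
    unfolding per by (subst sum.swap) (simp add: sum_distrib_right)
  also have "\<dots> = (\<Sum>e<2. 2 ^ J * dtft (approx h J x) (\<zeta> / 2 + real e / 2) * cnj (dtft f (\<zeta> / 2 + real e / 2)))"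
    unfolding A by simp
  also have "\<dots> / 2 ^ Suc J = (\<Sum>e<2. dtft (approx h J x) (\<zeta> / 2 + real e / 2) * cnj (dtft f (\<zeta> / 2 + real e / 2))) / 2"
    by (simp add: sum_distrib_left[symmetric] mult.assoc)
  finally show "dtft y \<zeta> = (dtft (approx h J x) (\<zeta> / 2) * cnj (dtft f (\<zeta> / 2))
      + dtft (approx h J x) (\<zeta> / 2 + 1/2) * cnj (dtft f (\<zeta> / 2 + 1/2))) / 2"
    by (simp add: numeral_2_eq_2)
qed

text \<open>In frequency the pair of outputs of a level is the adjoint modulation matrix, up to
  normalisation, applied to the pair of folded values of the input. As \<open>\<zeta>\<close> runs through
  the \<open>N\<close>-th grid, these values run through the \<open>2 N\<close>-th grid.\<close>

lemma energy_one_level: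
  assumes h: "fin_supp h" and g: "fin_supp g" and x: "fin_supp x"
    and M: "\<And>\<xi>. \<xi> \<in> {-1/2<..<1/2} \<Longrightarrow> expanding_at h g \<xi>"
  shows "energy (approx h J x) \<le> energy (analysis h g (Suc J) x) + energy (approx h (Suc J) x)"
proof -
  define y where "y = analysis h g (Suc J) x"
  define z where "z = approx h (Suc J) x"
  define A where "A = dtft (approx h J x)"
  have Y: "fin_supp y" "\<And>\<zeta>. dtft y \<zeta> = (A (\<zeta> / 2) * cnj (dtft g (\<zeta> / 2)) + A (\<zeta> / 2 + 1/2) * cnj (dtft g (\<zeta> / 2 + 1/2))) / 2"
    unfolding A_def by (rule dtft_next_level[OF h g x]; simp add: y_def analysis_def iter_high_def)+
  have Z: "fin_supp z" "\<And>\<zeta>. dtft z \<zeta> = (A (\<zeta> / 2) * cnj (dtft h (\<zeta> / 2)) + A (\<zeta> / 2 + 1/2) * cnj (dtft h (\<zeta> / 2 + 1/2))) / 2"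
    unfolding A_def by (rule dtft_next_level[OF h h x]; simp add: z_def approx_def)+
  have fa: "fin_supp (approx h J x)"
    unfolding approx_def using dtft_inner_translates(1)[OF x] dtft_iter_low[OF h] by blast
  from eventually_conj[OF parseval[OF Y(1)] eventually_conj[OF parseval[OF Z(1)] parseval[OF fa]]]
  obtain N0 where N0: "\<And>N. N \<ge> N0 \<Longrightarrow> energy y = (\<Sum>r<N. (cmod (dtft y (real r / real N)))\<^sup>2) / real N"
    "\<And>N. N \<ge> N0 \<Longrightarrow> energy z = (\<Sum>r<N. (cmod (dtft z (real r / real N)))\<^sup>2) / real N"
    "\<And>N. N \<ge> N0 \<Longrightarrow> energy (approx h J x) = (\<Sum>r<N. (cmod (A (real r / real N)))\<^sup>2) / real N"
    unfolding eventually_sequentially A_def by auto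
  define N where "N = Suc N0"
  have N: "N \<ge> N0" "2 * N \<ge> N0" "N > 0" by (simp_all add: N_def)
  have pt: "((cmod (A (\<zeta> / 2)))\<^sup>2 + (cmod (A (\<zeta> / 2 + 1/2)))\<^sup>2) / 2 \<le> (cmod (dtft y \<zeta>))\<^sup>2 + (cmod (dtft z \<zeta>))\<^sup>2"
    if "0 \<le> \<zeta>" "\<zeta> < 1" for \<zeta>
  proof -
    have "expanding_at h g (\<zeta> / 2)" by (rule M) (use that in auto)
    moreover have half: "2 * (u / 2) = u" for u :: complex by simp
    ultimately have "2 * ((cmod (A (\<zeta> / 2)))\<^sup>2 + (cmod (A (\<zeta> / 2 + 1/2)))\<^sup>2)
      \<le> (cmod (2 * dtft y \<zeta>))\<^sup>2 + (cmod (2 * dtft z \<zeta>))\<^sup>2"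
      using adjoint_expanding[where ?w0.0 = "A (\<zeta> / 2)" and ?w1.0 = "A (\<zeta> / 2 + 1/2)"
          and ?g0.0 = "dtft g (\<zeta> / 2)" and ?g1.0 = "dtft g (\<zeta> / 2 + 1/2)"
          and ?h0.0 = "dtft h (\<zeta> / 2)" and ?h1.0 = "dtft h (\<zeta> / 2 + 1/2)"]
      unfolding expanding_at_def Y Z half by simp
    then show ?thesis by (simp add: norm_mult power_mult_distrib)
  qed
  have "energy (approx h J x) = (\<Sum>r<2 * N. (cmod (A (real r / real (2 * N))))\<^sup>2) / real (2 * N)"
    by (rule N0(3)[OF N(2)])
  also have "(\<Sum>r<2 * N. (cmod (A (real r / real (2 * N))))\<^sup>2)
      = (\<Sum>q<N. \<Sum>k<2. (cmod (A ((real q / real N + real k) / real 2)))\<^sup>2)"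
    by (rule sum_grid_cosets) (use N in auto)
  also have "\<dots> / real (2 * N) = (\<Sum>q<N. ((cmod (A (real q / real N / 2)))\<^sup>2 + (cmod (A (real q / real N / 2 + 1/2)))\<^sup>2) / 2) / real N"
    by (simp add: numeral_2_eq_2 add_divide_distrib sum_divide_distrib mult.commute)
  also have "\<dots> \<le> (\<Sum>q<N. (cmod (dtft y (real q / real N)))\<^sup>2 + (cmod (dtft z (real q / real N)))\<^sup>2) / real N"
    by (intro divide_right_mono sum_mono pt) auto
  also have "\<dots> = energy y + energy z"
    unfolding N0(1)[OF N(1)] N0(2)[OF N(1)] by (simp add: sum.distrib add_divide_distrib)
  finally show ?thesis by (simp add: y_def z_def)
qed

lemma energy_le_details:
  assumes h: "fin_supp h" and g: "fin_supp g" and x: "fin_supp x"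
    and M: "\<And>\<xi>. \<xi> \<in> {-1/2<..<1/2} \<Longrightarrow> expanding_at h g \<xi>"
    and \<delta>: "\<delta> > 0" "\<delta> < 1" and lb: "low_pass_decay h \<delta>"
    and U: "\<And>J. (\<Sum>j<J. energy (analysis h g (Suc j) x)) \<le> U"
  shows "energy x \<le> U"
proof -
  obtain D where D: "\<And>J. energy (approx h J x) \<le> D * (2 powr (- \<delta>)) ^ J"
    using approx_energy_decay[OF h \<delta> lb x] by blast
  have tele: "energy x \<le> (\<Sum>j<J. energy (analysis h g (Suc j) x)) + energy (approx h J x)" for J
  proof (induction J)
    case (Suc J)
    then show ?case using energy_one_level[OF h g x M, of J] by simp
  qed (simp add: approx_0)
  have "energy x \<le> U + D * (2 powr (- \<delta>)) ^ J" for J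
    using tele[of J] U[of J] D[of J] by linarith
  moreover have "(\<lambda>J. U + D * (2 powr (- \<delta>)) ^ J) \<longlonglongrightarrow> U + D * 0"
    using powr_less_mono[of "- \<delta>" 0 2] \<delta>
    by (intro tendsto_intros LIMSEQ_realpow_zero) auto
  ultimately show ?thesis by (intro LIMSEQ_le_const[of _ U]) auto
qed

section \<open>From finitely supported sequences to square-summable ones\<close>

lemma ell2_iff: "x \<in> ell2 \<longleftrightarrow> (\<lambda>n. (cmod (x n))\<^sup>2) summable_on UNIV"
  by (simp add: ell2_def)

lemma sum_le_energy:
  assumes "x \<in> ell2" "finite F"
  shows "(\<Sum>k\<in>F. (cmod (x k))\<^sup>2) \<le> energy x"
  unfolding energy_def using assms by (intro finite_sum_le_infsum) (auto simp: ell2_iff)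

lemma ell2_and_energy_le:
  assumes "\<And>F. finite F \<Longrightarrow> (\<Sum>k\<in>F. (cmod (x k))\<^sup>2) \<le> U"
  shows "x \<in> ell2" and "energy x \<le> U"
proof -
  show s: "x \<in> ell2"
    unfolding ell2_iff by (rule nonneg_bdd_above_summable_on) (use assms in \<open>auto intro!: bdd_aboveI[of _ U]\<close>)
  show "energy x \<le> U"
    unfolding energy_def using s assms by (intro infsum_le_finite_sums) (auto simp: ell2_iff)
qed

definition trunc :: "nat \<Rightarrow> (int \<Rightarrow> complex) \<Rightarrow> int \<Rightarrow> complex" where
  "trunc R x k = (if \<bar>k\<bar> \<le> int R then x k else 0)"

lemma fin_supp_trunc: "fin_supp (trunc R x)"
  by (rule finite_subset[of _ "{- int R..int R}"]) (auto simp: trunc_def split: if_splits)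

lemma energy_trunc: "energy (trunc R x) = (\<Sum>k\<in>{- int R..int R}. (cmod (x k))\<^sup>2)"
proof -
  have "energy (trunc R x) = (\<Sum>k\<in>{- int R..int R}. (cmod (trunc R x k))\<^sup>2)"
    unfolding energy_def by (rule infsum_eq_sum) (auto simp: trunc_def)
  also have "\<dots> = (\<Sum>k\<in>{- int R..int R}. (cmod (x k))\<^sup>2)"
    by (rule sum.cong) (auto simp: trunc_def)
  finally show ?thesis .
qed

lemma finite_int_bounded:
  assumes "finite (F :: int set)"
  shows "eventually (\<lambda>R. F \<subseteq> {- int R..int R}) sequentially"
proof -
  have "eventually (\<lambda>R. \<forall>k\<in>F. k \<in> {- int R..int R}) sequentially"
    using assms
  proof (intro eventually_ball_finite ballI)
    fix k
    show "eventually (\<lambda>R. k \<in> {- int R..int R}) sequentially"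
      using eventually_ge_at_top[of "nat \<bar>k\<bar>"] by eventually_elim auto
  qed
  then show ?thesis by eventually_elim blast
qed

text \<open>Every finite sum is at most the energy of some truncation, and a truncation and its remainder have
  disjoint supports.\<close>

lemma truncation_error:
  assumes x: "x \<in> ell2" and e: "\<epsilon> > 0"
  obtains R where "energy x \<le> energy (trunc R x) + \<epsilon>"
    "(\<lambda>k. x k - trunc R x k) \<in> ell2" "energy (\<lambda>k. x k - trunc R x k) \<le> \<epsilon>"
proof -
  have "\<exists>F. finite F \<and> energy x - \<epsilon> < (\<Sum>k\<in>F. (cmod (x k))\<^sup>2)"
  proof (rule ccontr)
    assume "\<not> ?thesis"
    then have "energy x \<le> energy x - \<epsilon>" by (intro ell2_and_energy_le(2)) (auto simp: not_less)
    then show False using e by simp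
  qed
  then obtain F where F: "finite F" "energy x - \<epsilon> < (\<Sum>k\<in>F. (cmod (x k))\<^sup>2)" by blast
  obtain R where R: "F \<subseteq> {- int R..int R}"
    using finite_int_bounded[OF F(1)] unfolding eventually_sequentially by blast
  have "(\<Sum>k\<in>F. (cmod (x k))\<^sup>2) \<le> energy (trunc R x)"
    unfolding energy_trunc by (rule sum_mono2) (use R in auto)
  then have 1: "energy x \<le> energy (trunc R x) + \<epsilon>" using F by simp
  have 2: "(\<Sum>k\<in>G. (cmod (x k - trunc R x k))\<^sup>2) \<le> \<epsilon>" if G: "finite G" for G
  proof -
    have "(\<Sum>k\<in>G. (cmod (x k - trunc R x k))\<^sup>2) = (\<Sum>k\<in>G - {- int R..int R}. (cmod (x k))\<^sup>2)"
      by (rule sum.mono_neutral_cong_right) (use G in \<open>auto simp: trunc_def\<close>)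
    also have "\<dots> + energy (trunc R x) = (\<Sum>k\<in>G \<union> {- int R..int R}. (cmod (x k))\<^sup>2)"
      unfolding energy_trunc by (subst sum.union_disjoint[symmetric]) (use G in \<open>auto intro!: sum.cong\<close>)
    also have "\<dots> \<le> energy x" by (rule sum_le_energy[OF x]) (use G in simp)
    finally show ?thesis using 1 by simp
  qed
  show thesis using that[OF 1] ell2_and_energy_le[OF 2] by blast
qed

lemma analysis_finite_window:
  assumes "fin_supp (iter_high h g j)"
  obtains W where "finite W" "\<And>x. analysis h g j x k = (\<Sum>m\<in>W. x m * cnj (iter_high h g j (m - 2 ^ j * k)))"
proof
  show "finite ((\<lambda>n. n + 2 ^ j * k) ` {n. iter_high h g j n \<noteq> 0})" using assms by simp
  show "analysis h g j x k = (\<Sum>m\<in>(\<lambda>n. n + 2 ^ j * k) ` {n. iter_high h g j n \<noteq> 0}. x m * cnj (iter_high h g j (m - 2 ^ j * k)))" for x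
    unfolding analysis_eq_inner
  proof (rule infsum_eq_sum)
    fix m assume m: "m \<notin> (\<lambda>n. n + 2 ^ j * k) ` {n. iter_high h g j n \<noteq> 0}"
    have "iter_high h g j (m - 2 ^ j * k) = 0"
    proof (rule ccontr)
      assume "iter_high h g j (m - 2 ^ j * k) \<noteq> 0"
      then have "m \<in> (\<lambda>n. n + 2 ^ j * k) ` {n. iter_high h g j n \<noteq> 0}"
        by (intro image_eqI[of _ _ "m - 2 ^ j * k"]) auto
      with m show False by simp
    qed
    then show "x m * cnj (iter_high h g j (m - 2 ^ j * k)) = 0" by simp
  qed (use assms in simp)
qed

lemma analysis_diff:
  assumes "fin_supp (iter_high h g j)"
  shows "analysis h g j (\<lambda>m. x m - y m) k = analysis h g j x k - analysis h g j y k"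
proof -
  obtain W where "\<And>x. analysis h g j x k = (\<Sum>m\<in>W. x m * cnj (iter_high h g j (m - 2 ^ j * k)))"
    using analysis_finite_window[OF assms] by metis
  then show ?thesis by (simp add: left_diff_distrib sum_subtractf)
qed

lemma analysis_trunc:
  assumes "fin_supp (iter_high h g j)"
  shows "eventually (\<lambda>R. analysis h g j (trunc R x) k = analysis h g j x k) sequentially"
proof -
  obtain W where W: "finite W" "\<And>x. analysis h g j x k = (\<Sum>m\<in>W. x m * cnj (iter_high h g j (m - 2 ^ j * k)))"
    using analysis_finite_window[OF assms] by metis
  show ?thesis
    using finite_int_bounded[OF W(1)]
    by eventually_elim (unfold W(2), rule sum.cong[OF refl], fastforce simp: trunc_def abs_le_iff dest: subsetD)
qed

text \<open>Finitely many coefficients of \<open>x\<close> agree with those of a truncation of \<open>x\<close>, so the upper bound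
  passes to the limit for every finite partial sum. For the lower bound, the details of a truncation
  are those of \<open>x\<close> minus those of the remainder, whose energy is small by the upper bound; the
  crude inequality \<open>\<bar>a - b\<bar>^2 \<le> 2 \<bar>a\<bar>^2 + 2 \<bar>b\<bar>^2\<close> suffices and yields the constant \<open>1/2\<close>.\<close>

lemma stable_from_finite_support:
  assumes f: "\<And>j. fin_supp (iter_high h g (Suc j))" and B: "B \<ge> 0"
    and upper: "\<And>x J. fin_supp x \<Longrightarrow> (\<Sum>j<J. energy (analysis h g (Suc j) x)) \<le> B * energy x"
    and lower: "\<And>x U. fin_supp x \<Longrightarrow> (\<And>J. (\<Sum>j<J. energy (analysis h g (Suc j) x)) \<le> U) \<Longrightarrow> energy x \<le> U"
  shows "stable_filter_bank h g"
proof -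
  have fin: "(\<Sum>j<J. \<Sum>k\<in>F j. (cmod (analysis h g (Suc j) x k))\<^sup>2) \<le> B * energy x"
    if x: "x \<in> ell2" and F: "\<And>j. finite (F j)" for x J F
  proof -
    have "eventually (\<lambda>R. \<forall>(j, k)\<in>Sigma {..<J} F.
        analysis h g (Suc j) (trunc R x) k = analysis h g (Suc j) x k) sequentially"
      using F by (intro eventually_ball_finite) (auto intro!: analysis_trunc f)
    then obtain R where R: "\<And>j k. j < J \<Longrightarrow> k \<in> F j \<Longrightarrow>
        analysis h g (Suc j) (trunc R x) k = analysis h g (Suc j) x k"
      unfolding eventually_sequentially by force
    have "(\<Sum>j<J. \<Sum>k\<in>F j. (cmod (analysis h g (Suc j) x k))\<^sup>2)
        = (\<Sum>j<J. \<Sum>k\<in>F j. (cmod (analysis h g (Suc j) (trunc R x) k))\<^sup>2)"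
      by (intro sum.cong) (auto simp: R)
    also have "\<dots> \<le> (\<Sum>j<J. energy (analysis h g (Suc j) (trunc R x)))"
    proof (intro sum_mono sum_le_energy F)
      fix j
      have "fin_supp (analysis h g (Suc j) (trunc R x))"
        unfolding analysis_def by (rule dtft_inner_translates(1)[OF fin_supp_trunc f])
      then show "analysis h g (Suc j) (trunc R x) \<in> ell2"
        unfolding ell2_iff by (rule_tac finite_nonzero_values_imp_summable_on) (simp add: conj_commute)
    qed
    also have "\<dots> \<le> B * energy (trunc R x)" by (rule upper[OF fin_supp_trunc])
    also have "\<dots> \<le> B * energy x"
      unfolding energy_trunc by (intro mult_left_mono sum_le_energy x B) simp
    finally show ?thesis .
  qed
  have inl2: "analysis h g (Suc j) x \<in> ell2" if x: "x \<in> ell2" for x j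
  proof (rule ell2_and_energy_le(1))
    fix G :: "int set" assume G: "finite G"
    have "(\<Sum>k\<in>G. (cmod (analysis h g (Suc j) x k))\<^sup>2)
        = (\<Sum>i<Suc j. \<Sum>k\<in>(if i = j then G else {}). (cmod (analysis h g (Suc i) x k))\<^sup>2)"
      by simp
    also have "\<dots> \<le> B * energy x" by (rule fin[OF x]) (use G in auto)
    finally show "(\<Sum>k\<in>G. (cmod (analysis h g (Suc j) x k))\<^sup>2) \<le> B * energy x" .
  qed
  have partial: "(\<Sum>j<J. energy (analysis h g (Suc j) x)) \<le> B * energy x" if x: "x \<in> ell2" for x J
  proof -
    have "(\<Sum>j<J. energy (analysis h g (Suc j) x)) \<le> B * energy x + \<epsilon>" if e: "\<epsilon> > 0" for \<epsilon>
    proof -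
      \<comment> \<open>Each of the \<open>J\<close> levels is truncated with its own small error.\<close>
      define \<eta> where "\<eta> = \<epsilon> / real (Suc J)"
      have eta: "\<eta> > 0" using e by (simp add: \<eta>_def)
      have "\<exists>R. energy (analysis h g (Suc j) x) \<le> energy (trunc R (analysis h g (Suc j) x)) + \<eta>" for j
        using truncation_error[OF inl2[OF x] eta] by metis
      then obtain R where R: "\<And>j. energy (analysis h g (Suc j) x) \<le> energy (trunc (R j) (analysis h g (Suc j) x)) + \<eta>"
        by metis
      have "(\<Sum>j<J. energy (analysis h g (Suc j) x)) \<le> (\<Sum>j<J. energy (trunc (R j) (analysis h g (Suc j) x)) + \<eta>)"
        by (rule sum_mono) (rule R)
      also have "\<dots> \<le> B * energy x + real J * \<eta>"
        unfolding energy_trunc sum.distrib using fin[OF x, of "\<lambda>j. {- int (R j)..int (R j)}" J] by simp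
      also have "real J * \<eta> \<le> \<epsilon>" using e by (simp add: \<eta>_def field_simps)
      finally show ?thesis by simp
    qed
    then show ?thesis by (rule field_le_epsilon)
  qed
  define e where "e x j = energy (analysis h g j x)" for x j
  have fin_e: "sum (e x) F \<le> B * energy x" if x: "x \<in> ell2" and F: "finite F" "F \<subseteq> {1..}" for x F
  proof -
    obtain J where J: "\<forall>j\<in>F. j < J" using F(1) finite_nat_set_iff_bounded by blast
    have "F \<subseteq> Suc ` {..<J}"
    proof
      fix j assume "j \<in> F"
      then have "j = Suc (j - 1)" "j - 1 < J" using F J by force+
      then show "j \<in> Suc ` {..<J}" by blast
    qed
    then have "sum (e x) F \<le> sum (e x) (Suc ` {..<J})"
      by (intro sum_mono2) (auto simp: e_def energy_nonneg)
    also have "\<dots> = (\<Sum>j<J. energy (analysis h g (Suc j) x))" by (simp add: sum.reindex e_def)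
    finally show ?thesis using partial[OF x, of J] by simp
  qed
  have summ: "e x summable_on {1..}" if x: "x \<in> ell2" for x
    by (rule nonneg_bdd_above_summable_on)
       (use fin_e[OF x] in \<open>auto simp: e_def[abs_def] energy_nonneg intro!: bdd_aboveI[of _ "B * energy x"]\<close>)
  have le: "infsum (e x) {1..} \<le> B * energy x" if x: "x \<in> ell2" for x
    by (rule infsum_le_finite_sums[OF summ[OF x] fin_e[OF x]])
  have ge: "energy x \<le> 2 * infsum (e x) {1..}" if x: "x \<in> ell2" for x
  proof (rule field_le_epsilon)
    fix \<epsilon> :: real assume e: "\<epsilon> > 0"
    define \<eta> where "\<eta> = \<epsilon> / (1 + 2 * B)"
    have eta: "\<eta> > 0" using e B by (simp add: \<eta>_def)
    obtain R where R: "energy x \<le> energy (trunc R x) + \<eta>"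
      and y: "(\<lambda>k. x k - trunc R x k) \<in> ell2" "energy (\<lambda>k. x k - trunc R x k) \<le> \<eta>"
      using truncation_error[OF x eta] by blast
    define y where "y k = x k - trunc R x k" for k
    have y: "y \<in> ell2" "energy y \<le> \<eta>" using y by (simp_all add: y_def[abs_def])
    have split: "energy (analysis h g (Suc j) (trunc R x)) \<le> 2 * e x (Suc j) + 2 * e y (Suc j)" for j
    proof (rule ell2_and_energy_le(2))
      fix F :: "int set" assume F: "finite F"
      let ?a = "\<lambda>x k. analysis h g (Suc j) x k"
      have tr: "trunc R x = (\<lambda>k. x k - y k)" by (simp add: y_def)
      have "(cmod (?a (trunc R x) k))\<^sup>2 \<le> 2 * (cmod (?a x k))\<^sup>2 + 2 * (cmod (?a y k))\<^sup>2" for k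
      proof -
        have "(cmod (?a (trunc R x) k))\<^sup>2 = (cmod (?a x k - ?a y k))\<^sup>2"
          by (simp only: tr analysis_diff[OF f])
        also have "\<dots> \<le> (cmod (?a x k) + cmod (?a y k))\<^sup>2" by (intro power_mono norm_triangle_ineq4) simp
        also have "\<dots> \<le> 2 * (cmod (?a x k))\<^sup>2 + 2 * (cmod (?a y k))\<^sup>2"
          using zero_le_power2[of "cmod (?a x k) - cmod (?a y k)"] by (simp add: power2_eq_square algebra_simps)
        finally show ?thesis .
      qed
      then have "(\<Sum>k\<in>F. (cmod (?a (trunc R x) k))\<^sup>2)
          \<le> (\<Sum>k\<in>F. 2 * (cmod (?a x k))\<^sup>2 + 2 * (cmod (?a y k))\<^sup>2)" by (intro sum_mono) auto
      also have "\<dots> = 2 * (\<Sum>k\<in>F. (cmod (?a x k))\<^sup>2) + 2 * (\<Sum>k\<in>F. (cmod (?a y k))\<^sup>2)"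
        by (simp add: sum.distrib sum_distrib_left)
      also have "\<dots> \<le> 2 * e x (Suc j) + 2 * e y (Suc j)"
        unfolding e_def using sum_le_energy[OF inl2[OF x] F] sum_le_energy[OF inl2[OF y(1)] F]
        by (intro add_mono mult_left_mono) auto
      finally show "(\<Sum>k\<in>F. (cmod (?a (trunc R x) k))\<^sup>2) \<le> 2 * e x (Suc j) + 2 * e y (Suc j)" .
    qed
    have "energy (trunc R x) \<le> 2 * infsum (e x) {1..} + 2 * (B * \<eta>)"
    proof (rule lower[OF fin_supp_trunc])
      fix J
      have "(\<Sum>j<J. energy (analysis h g (Suc j) (trunc R x))) \<le> (\<Sum>j<J. 2 * e x (Suc j) + 2 * e y (Suc j))"
        by (rule sum_mono) (rule split)
      also have "\<dots> = 2 * (\<Sum>j<J. e x (Suc j)) + 2 * (\<Sum>j<J. e y (Suc j))"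
        by (simp add: sum.distrib sum_distrib_left)
      also have "(\<Sum>j<J. e x (Suc j)) = sum (e x) (Suc ` {..<J})" by (simp add: sum.reindex)
      also have "\<dots> \<le> infsum (e x) {1..}"
        by (rule finite_sum_le_infsum[OF summ[OF x]]) (auto simp: e_def energy_nonneg)
      also have "(\<Sum>j<J. e y (Suc j)) \<le> B * \<eta>"
        using partial[OF y(1), of J] mult_left_mono[OF y(2) B] by (simp add: e_def)
      finally show "(\<Sum>j<J. energy (analysis h g (Suc j) (trunc R x))) \<le> 2 * infsum (e x) {1..} + 2 * (B * \<eta>)"
        by simp
    qed
    then have "energy x \<le> 2 * infsum (e x) {1..} + (1 + 2 * B) * \<eta>" using R by (simp add: algebra_simps)
    also have "(1 + 2 * B) * \<eta> = \<epsilon>" using B by (simp add: \<eta>_def)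
    finally show "energy x \<le> 2 * infsum (e x) {1..} + \<epsilon>" .
  qed
  show ?thesis
    unfolding stable_filter_bank_def ell2_norm_sq
  proof (rule exI[of _ "1/2 :: real"], rule exI[of _ "max B 1"], intro conjI ballI allI impI)
    fix x assume x: "x \<in> ell2"
    show "analysis h g j x \<in> ell2" if "j \<ge> 1" for j
      using inl2[OF x, of "j - 1"] that by simp
    show "(\<lambda>j. energy (analysis h g j x)) summable_on {1..}" using summ[OF x] by (simp add: e_def[abs_def])
    show "1/2 * energy x \<le> (\<Sum>\<^sub>\<infinity>j\<in>{1..}. energy (analysis h g j x))"
      using ge[OF x] by (simp add: e_def[abs_def])
    have "B * energy x \<le> max B 1 * energy x" by (intro mult_right_mono energy_nonneg) simp
    then show "(\<Sum>\<^sub>\<infinity>j\<in>{1..}. energy (analysis h g j x)) \<le> max B 1 * energy x"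
      using le[OF x] by (simp add: e_def[abs_def])
  qed auto
qed

section \<open>Stability\<close>

text \<open>All that is left is the choice of \<open>\<delta>\<close>: the supremum stays below the bound with exponent
  \<open>n - (1 + 3 \<delta>) / 2\<close> for small \<open>\<delta>\<close>, by continuity. Taking \<open>\<delta> < 1/3\<close> keeps this
  exponent nonnegative.\<close>

theorem theorem5p3:
  fixes h g :: "int \<Rightarrow> complex" and p :: "real \<Rightarrow> complex" and n s :: nat
  assumes "h \<in> ell2" and "g \<in> ell2"
    and "low_pass h" and "high_pass g"
    and "finite {k. g k \<noteq> 0}"
    and "n \<ge> 1"
    and "trig_poly p" and "p 0 = 1"
    and "\<And>\<xi>. dtft h \<xi> =
      of_real (sqrt 2) * ((1 + exp (2 * of_real pi * \<i> * of_real \<xi>)) / 2) ^ n * p \<xi>"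
    and "s \<ge> 1"
    and "(SUP \<xi>. cmod (\<Prod>k<s. p (2 ^ k * \<xi>))) < 2 powr ((real n - 1/2) * real s)"
    and "expanding_ae (modulation_matrix h g)"
  shows "stable_filter_bank h g"
proof -
  note g = \<open>finite {k. g k \<noteq> 0}\<close>
  have "dtft h = (\<lambda>\<xi>. of_real (sqrt 2) * ((1 + exp (2 * of_real pi * \<i> * of_real \<xi>)) / 2) ^ n * p \<xi>)"
    using assms(9) by (rule ext)
  then have "trig_poly (dtft h)"
    by (simp only:) (intro trig_poly_mult trig_poly_power trig_poly_const trig_poly_cosine_factor assms(7))
  moreover have "dtft h 0 \<noteq> 0" using \<open>low_pass h\<close> by (simp add: low_pass_def)
  ultimately have h: "fin_supp h" by (intro fin_supp_of_dtft_trig_poly)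
  obtain P where P: "P \<ge> 1" "\<And>\<xi>. cmod (p \<xi>) \<le> P" using trig_poly_bounded[OF assms(7)] by blast
  have "cmod (\<Prod>k<s. p (2 ^ k * \<xi>)) \<le> P ^ s" for \<xi>
    unfolding prod_norm[symmetric] by (rule order_trans[OF prod_mono[where g = "\<lambda>_. P"]]) (use P in auto)
  then have bdd: "bdd_above (range (\<lambda>\<xi>. cmod (\<Prod>k<s. p (2 ^ k * \<xi>))))" by (auto intro!: bdd_aboveI)
  define \<theta> where "\<theta> = (SUP \<xi>. cmod (\<Prod>k<s. p (2 ^ k * \<xi>)))"
  have \<theta>: "cmod (\<Prod>k<s. p (2 ^ k * \<xi>)) \<le> \<theta>" for \<xi>
    unfolding \<theta>_def by (rule cSUP_upper[OF _ bdd]) simp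
  have "((\<lambda>\<delta>. 2 powr ((real n - (1 + 3 * \<delta>) / 2) * real s)) \<longlongrightarrow> 2 powr ((real n - (1 + 3 * 0) / 2) * real s)) (at_right 0)"
    by (intro tendsto_intros) auto
  then have "eventually (\<lambda>\<delta>. \<theta> < 2 powr ((real n - (1 + 3 * \<delta>) / 2) * real s)) (at_right 0)"
    by (rule order_tendstoD) (use assms(11) in \<open>simp add: \<theta>_def\<close>)
  moreover have "eventually (\<lambda>\<delta>::real. \<delta> \<in> {0<..<1/3}) (at_right 0)"
    by (rule eventually_at_right_real) simp
  ultimately have "eventually (\<lambda>\<delta>. \<theta> < 2 powr ((real n - (1 + 3 * \<delta>) / 2) * real s) \<and> \<delta> \<in> {0<..<1/3}) (at_right 0)"
    by (rule eventually_conj)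
  then obtain \<delta> where \<delta>: "\<theta> < 2 powr ((real n - (1 + 3 * \<delta>) / 2) * real s)" "0 < \<delta>" "\<delta> < 1/3"
    by (auto dest!: eventually_happens simp: trivial_limit_at_right_real)
  have ps: "cmod (\<Prod>k<s. p (2 ^ k * \<xi>)) \<le> 2 powr ((real n - (1 + 3 * \<delta>) / 2) * real s)" for \<xi>
    using \<theta>[of \<xi>] \<delta>(1) by simp
  have "(1 + 3 * \<delta>) / 2 \<le> real n" using \<delta> \<open>n \<ge> 1\<close> by simp
  then have lb: "low_pass_decay h \<delta>"
    unfolding low_pass_decay_def using low_pass_product_bound[OF assms(7,8,10) ps _ assms(9)] by metis
  have g0: "dtft g 0 = 0" using \<open>high_pass g\<close> by (simp add: high_pass_def)
  obtain B where B: "B \<ge> 0"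
    "\<And>x J. fin_supp x \<Longrightarrow> (\<Sum>j<J. energy (analysis h g (Suc j) x)) \<le> B * energy x"
    using detail_energy_sum_le[OF h g g0 \<delta>(2) lb] by blast
  show ?thesis
  proof (rule stable_from_finite_support[OF dtft_iter_high(1)[OF h g] B])
    fix x U
    assume x: "fin_supp x" and U: "\<And>J. (\<Sum>j<J. energy (analysis h g (Suc j) x)) \<le> U"
    show "energy x \<le> U"
      by (rule energy_le_details[OF h g x expanding_everywhere[OF h g assms(12)] \<delta>(2) _ lb U])
        (use \<delta> in auto)
  qed
qed

end
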